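(* Let $(\Omega,\mathcal F)$ be a measurable space and let $\mathcal P$ be a convex family of probability measures on $\mathcal F$. If $\mathcal P$ is Hahn-localizable, then the map $l:\mathbb L^\infty(\mathcal P)\to \mathrm{ca}(\mathcal P)'$, $l(f)(\mu)=\int_\Omega f\,d\mu$, is an isometric isomorphism of $\mathbb L^\infty(\mathcal P)$ onto the dual space $\mathrm{ca}(\mathcal P)'$ of $\mathrm{ca}(\mathcal P)$.
   Context: $\mathcal N_{\mathcal P}=\{N\in\mathcal F: P(N)=0\ \forall P\in\mathcal P\}$; a subset of $\Omega$ is $\mathcal P$-polar if it is contained in some $N\in\mathcal N_{\mathcal P}$; a property holds $\mathcal P$-quasi-surely ($\mathcal P$-q.s.) if it holds outside a $\mathcal P$-polar set. $\mathbb L^\infty(\mathcal P)=\mathbb L^\infty(\mathcal F,\mathcal P)$ is the space of $\mathcal F$-measurable real functions $f$ with $|f|\le M$ $\mathcal P$-q.s. for some $M$, modulo $\mathcal P$-q.s. equality, with norm $\|f\|=\inf\{M>0: |f|\le M\ \mathcal P\text{-q.s.}\}$. For families $\mathcal P,\mathcal Q$ of probability measures write $\mathcal P\lll\mathcal Q$ if for every $P\in\mathcal P$ there is $Q\in\mathcal Q$ with $P\ll Q$. $\mathrm{sconv}(\mathcal Q)$ is the set of all countable convex combinations $\sum_k\lambda_kQ_k$ ($\lambda_k\ge0$, $\sum_k\lambda_k=1$, $Q_k\in\mathcal Q$). $\mathrm{ca}(\mathcal P)$ is the set of finite signed measures $\mu$ on $\mathcal F$ with $|\mu|\ll P$ for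 at least one $P\in\mathcal P$, equipped with the total variation norm $\|\mu\|_{TV}=|\mu|(\Omega)$. The family $\mathcal P$ is pre-Hahn-localizable if there exist a family $\mathcal Q$ of probability measures on $\mathcal F$ (a localization) and sets $S_Q\in\mathcal F$, $Q\in\mathcal Q$ (supports), with $Q(S_R)=1$ if $Q=R$ and $Q(S_R)=0$ if $Q\neq R$ for all $Q,R\in\mathcal Q$, and $\mathcal Q\lll\mathcal P\lll\mathrm{sconv}(\mathcal Q)$. It is Hahn-localizable if this can be done so that in addition, for every family $\{E_Q\}_{Q\in\mathcal Q}$ with $E_Q\in\mathcal F$, $E_Q\subseteq S_Q$, there is $S\in\mathcal F$ with (a) $Q(E_Q\setminus S)=0$ for all $Q\in\mathcal Q$, and (b) whenever $F\in\mathcal F$ satisfies $Q(E_Q\setminus F)=0$ for all $Q\in\mathcal Q$, then $Q(S\setminus F)=0$ for all $Q\in\mathcal Q$. *)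

theory Defs
  imports "HOL-Probability.Probability"
begin

definition prob_family :: "'a measure \<Rightarrow> 'a measure set \<Rightarrow> bool" where
  "prob_family M \<P> \<longleftrightarrow> (\<forall>P\<in>\<P>. prob_space P \<and> sets P = sets M)"

definition mix_measure :: "'a measure \<Rightarrow> real \<Rightarrow> 'a measure \<Rightarrow> 'a measure \<Rightarrow> 'a measure" where
  "mix_measure M t P Q = measure_of (space M) (sets M)
      (\<lambda>A. ennreal t * emeasure P A + ennreal (1 - t) * emeasure Q A)"

definition convex_family :: "'a measure \<Rightarrow> 'a measure set \<Rightarrow> bool" where
  "convex_family M \<P> \<longleftrightarrow>
     (\<forall>P\<in>\<P>. \<forall>Q\<in>\<P>. \<forall>t::real. 0 \<le> t \<and> t \<le> 1 \<longrightarrow> mix_measure M t P Q \<in> \<P>)"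

definition polar :: "'a measure \<Rightarrow> 'a measure set \<Rightarrow> 'a set \<Rightarrow> bool" where
  "polar M \<P> S \<longleftrightarrow> (\<exists>N\<in>sets M. (\<forall>P\<in>\<P>. emeasure P N = 0) \<and> S \<subseteq> N)"

definition qs :: "'a measure \<Rightarrow> 'a measure set \<Rightarrow> ('a \<Rightarrow> bool) \<Rightarrow> bool" where
  "qs M \<P> Pr \<longleftrightarrow> polar M \<P> {x \<in> space M. \<not> Pr x}"

text \<open>L-infinity(P): representatives (equivalence classes are handled via qs-equality).\<close>

definition Linf :: "'a measure \<Rightarrow> 'a measure set \<Rightarrow> ('a \<Rightarrow> real) set" where
  "Linf M \<P> = {f. f \<in> borel_measurable M \<and> (\<exists>K. qs M \<P> (\<lambda>x. \<bar>f x\<bar> \<le> K))}"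

definition linf_norm :: "'a measure \<Rightarrow> 'a measure set \<Rightarrow> ('a \<Rightarrow> real) \<Rightarrow> real" where
  "linf_norm M \<P> f = Inf {K. K > 0 \<and> qs M \<P> (\<lambda>x. \<bar>f x\<bar> \<le> K)}"

definition fin_signed_measure :: "'a measure \<Rightarrow> ('a set \<Rightarrow> real) \<Rightarrow> bool" where
  "fin_signed_measure M \<mu> \<longleftrightarrow>
     (\<forall>A. A \<notin> sets M \<longrightarrow> \<mu> A = 0) \<and>
     (\<forall>A::nat \<Rightarrow> 'a set. range A \<subseteq> sets M \<longrightarrow> disjoint_family A \<longrightarrow>
        (\<lambda>n. \<mu> (A n)) sums \<mu> (\<Union>n. A n))"

definition pos_var :: "'a measure \<Rightarrow> ('a set \<Rightarrow> real) \<Rightarrow> 'a set \<Rightarrow> ennreal" where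
  "pos_var M \<mu> A = (SUP B\<in>{B \<in> sets M. B \<subseteq> A}. ennreal (\<mu> B))"

definition neg_var :: "'a measure \<Rightarrow> ('a set \<Rightarrow> real) \<Rightarrow> 'a set \<Rightarrow> ennreal" where
  "neg_var M \<mu> A = (SUP B\<in>{B \<in> sets M. B \<subseteq> A}. ennreal (- \<mu> B))"

definition tot_var :: "'a measure \<Rightarrow> ('a set \<Rightarrow> real) \<Rightarrow> 'a set \<Rightarrow> ennreal" where
  "tot_var M \<mu> A = pos_var M \<mu> A + neg_var M \<mu> A"

definition tv_norm :: "'a measure \<Rightarrow> ('a set \<Rightarrow> real) \<Rightarrow> real" where
  "tv_norm M \<mu> = enn2real (tot_var M \<mu> (space M))"

definition signed_integral :: "'a measure \<Rightarrow> ('a set \<Rightarrow> real) \<Rightarrow> ('a \<Rightarrow> real) \<Rightarrow> real" where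
  "signed_integral M \<mu> f =
     (\<integral>x. f x \<partial>(measure_of (space M) (sets M) (pos_var M \<mu>)))
   - (\<integral>x. f x \<partial>(measure_of (space M) (sets M) (neg_var M \<mu>)))"

definition ca :: "'a measure \<Rightarrow> 'a measure set \<Rightarrow> ('a set \<Rightarrow> real) set" where
  "ca M \<P> = {\<mu>. fin_signed_measure M \<mu> \<and>
     (\<exists>P\<in>\<P>. \<forall>N\<in>sets M. emeasure P N = 0 \<longrightarrow> tot_var M \<mu> N = 0)}"

definition ca_dual :: "'a measure \<Rightarrow> 'a measure set \<Rightarrow> (('a set \<Rightarrow> real) \<Rightarrow> real) set" where
  "ca_dual M \<P> = {\<phi>.
     (\<forall>\<mu>\<in>ca M \<P>. \<forall>\<nu>\<in>ca M \<P>. \<forall>a b::real.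
        \<phi> (\<lambda>A. a * \<mu> A + b * \<nu> A) = a * \<phi> \<mu> + b * \<phi> \<nu>) \<and>
     (\<exists>K. \<forall>\<mu>\<in>ca M \<P>. \<bar>\<phi> \<mu>\<bar> \<le> K * tv_norm M \<mu>)}"

definition dual_norm :: "'a measure \<Rightarrow> 'a measure set \<Rightarrow> (('a set \<Rightarrow> real) \<Rightarrow> real) \<Rightarrow> real" where
  "dual_norm M \<P> \<phi> = Inf {K. K \<ge> 0 \<and> (\<forall>\<mu>\<in>ca M \<P>. \<bar>\<phi> \<mu>\<bar> \<le> K * tv_norm M \<mu>)}"

text \<open>Localizations. P << Q is written absolutely_continuous Q P (null_sets Q \<subseteq> null_sets P).\<close>

definition abs_cont_fam :: "'a measure set \<Rightarrow> 'a measure set \<Rightarrow> bool" where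
  "abs_cont_fam \<P> \<Q> \<longleftrightarrow> (\<forall>P\<in>\<P>. \<exists>Q\<in>\<Q>. absolutely_continuous Q P)"

definition sconv :: "'a measure \<Rightarrow> 'a measure set \<Rightarrow> 'a measure set" where
  "sconv M \<Q> = {measure_of (space M) (sets M) (\<lambda>A. \<Sum>k. ennreal (c k) * emeasure (Qs k) A)
      | c Qs. (\<forall>k. 0 \<le> c k) \<and> c sums 1 \<and> range Qs \<subseteq> \<Q>}"

definition localization :: "'a measure \<Rightarrow> 'a measure set \<Rightarrow> 'a measure set \<Rightarrow> ('a measure \<Rightarrow> 'a set) \<Rightarrow> bool" where
  "localization M \<P> \<Q> S \<longleftrightarrow>
     prob_family M \<Q> \<and>
     (\<forall>Q\<in>\<Q>. S Q \<in> sets M) \<and>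
     (\<forall>Q\<in>\<Q>. \<forall>R\<in>\<Q>. emeasure Q (S R) = (if Q = R then 1 else 0)) \<and>
     abs_cont_fam \<Q> \<P> \<and> abs_cont_fam \<P> (sconv M \<Q>)"

definition pre_hahn_localizable :: "'a measure \<Rightarrow> 'a measure set \<Rightarrow> bool" where
  "pre_hahn_localizable M \<P> \<longleftrightarrow> (\<exists>\<Q> S. localization M \<P> \<Q> S)"

definition hahn_localizable :: "'a measure \<Rightarrow> 'a measure set \<Rightarrow> bool" where
  "hahn_localizable M \<P> \<longleftrightarrow> (\<exists>\<Q> S. localization M \<P> \<Q> S \<and>
     (\<forall>E. (\<forall>Q\<in>\<Q>. E Q \<in> sets M \<and> E Q \<subseteq> S Q) \<longrightarrow>
        (\<exists>T\<in>sets M. (\<forall>Q\<in>\<Q>. emeasure Q (E Q - T) = 0) \<and>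
           (\<forall>F\<in>sets M. (\<forall>Q\<in>\<Q>. emeasure Q (E Q - F) = 0) \<longrightarrow>
              (\<forall>Q\<in>\<Q>. emeasure Q (T - F) = 0)))))"

end

theory Submission
  imports Defs
begin

text \<open>The elements of \<open>ca(\<P>)\<close> are exactly the measures with an integrable density with respect to
  some \<open>P \<in> \<P>\<close>, and convexity allows any two of them to have a common dominating member of \<open>\<P>\<close>.
  Hence \<open>l(f)\<close> is linear and bounded, and testing it on measures
  \<open>\<plusminus>P(\<cdot> \<inter> A)\<close> gives isometry and injectivity.

  For surjectivity, a functional \<open>\<phi>\<close> restricted to the measures dominated by a member \<open>Q\<close> of the
  localization is a functional on \<open>L\<^sup>1(Q)\<close>, so it is represented by a bounded function \<open>f\<^sub>Q\<close>. Since
  the supports are disjoint up to null sets, the Hahn property, applied to \<open>S\<^sub>Q \<inter> {f\<^sub>Q > r}\<close> for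
  rational \<open>r\<close>, yields one measurable \<open>f\<close> with \<open>f = f\<^sub>Q\<close> almost surely under every \<open>Q\<close>. As every
  \<open>P \<in> \<P>\<close> is dominated by a countable mixture of such \<open>Q\<close>, it is concentrated on countably many of
  the supports, and its restriction to \<open>S\<^sub>Q\<close> is dominated by \<open>Q\<close>; so \<open>f\<close> represents \<open>\<phi>\<close> on the
  measures dominated by \<open>P\<close> too.\<close>

section \<open>Finite signed measures and their variations\<close>

text \<open>\<open>ennreal\<close> sends negative reals to 0 and is therefore subadditive, so each
  truncated partial sum is at most the full series of truncated terms; the bound passes to the
  limit.\<close>

lemma ennreal_le_suminf_of_sums:
  fixes x :: "nat \<Rightarrow> real"
  assumes "x sums s"
  shows "ennreal s \<le> (\<Sum>n. ennreal (x n))"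
proof (rule LIMSEQ_le_const2)
  show "(\<lambda>n. ennreal (\<Sum>i<n. x i)) \<longlonglongrightarrow> ennreal s"
    using assms by (intro tendsto_ennrealI) (simp add: sums_def)
  have "ennreal (\<Sum>i<n. x i) \<le> (\<Sum>i<n. ennreal (x i))" for n
  proof (induction n)
    case (Suc n)
    have "ennreal ((\<Sum>i<n. x i) + x n) \<le> ennreal (\<Sum>i<n. x i) + ennreal (x n)"
      using ennreal_leI[of "(\<Sum>i<n. x i) + x n" "\<Sum>i<n. x i"] ennreal_leI[of "(\<Sum>i<n. x i) + x n" "x n"]
      by (cases "x n \<ge> 0"; cases "(\<Sum>i<n. x i) \<ge> 0") (auto simp: ennreal_neg simp del: ennreal_plus simp flip: ennreal_plus)
    with Suc show ?case by (simp add: add_right_mono order_trans)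
  qed simp
  also have "(\<Sum>i<n. ennreal (x i)) \<le> (\<Sum>n. ennreal (x n))" for n
    by (intro sum_le_suminf) auto
  finally show "\<exists>N. \<forall>n\<ge>N. ennreal (\<Sum>i<n. x i) \<le> (\<Sum>n. ennreal (x n))" by blast
qed

lemma neg_var_eq_pos_var: "neg_var M \<mu> = pos_var M (\<lambda>A. - \<mu> A)"
  by (simp add: neg_var_def pos_var_def fun_eq_iff)

lemma fin_signed_measure_uminus:
  "fin_signed_measure M \<mu> \<Longrightarrow> fin_signed_measure M (\<lambda>A. - \<mu> A)"
  by (auto simp: fin_signed_measure_def intro: sums_minus)

lemma fin_signed_measure_sums:
  assumes "fin_signed_measure M \<mu>" "range A \<subseteq> sets M" "disjoint_family A"
  shows "(\<lambda>n. \<mu> (A n)) sums \<mu> (\<Union>n. A n)"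
  using assms by (auto simp: fin_signed_measure_def)

lemma fin_signed_measure_empty:
  assumes "fin_signed_measure M \<mu>"
  shows "\<mu> {} = 0"
proof -
  have "(\<lambda>n::nat. \<mu> {}) sums \<mu> (\<Union>n::nat. {})"
    using fin_signed_measure_sums[OF assms, of "\<lambda>_. {}"] by (simp add: disjoint_family_on_def)
  then show ?thesis
    using sums_summable summable_const_iff by blast
qed

lemma fin_signed_measure_Un:
  assumes \<mu>: "fin_signed_measure M \<mu>" and "A \<in> sets M" "B \<in> sets M" "A \<inter> B = {}"
  shows "\<mu> (A \<union> B) = \<mu> A + \<mu> B"
proof -
  have "(\<lambda>n. \<mu> (binaryset A B n)) sums \<mu> (\<Union>n. binaryset A B n)"
    using assms by (intro fin_signed_measure_sums[OF \<mu>])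
      (auto simp: range_binaryset_eq disjoint_family_on_def binaryset_def split: if_splits)
  moreover have "(\<lambda>n. \<mu> (binaryset A B n)) sums (\<mu> A + \<mu> B)"
    by (intro binaryset_sums fin_signed_measure_empty[OF \<mu>])
  ultimately show ?thesis
    by (simp add: UN_binaryset_eq sums_unique2)
qed

lemma fin_signed_measure_Diff:
  assumes "fin_signed_measure M \<mu>" "A \<in> sets M" "B \<in> sets M" "B \<subseteq> A"
  shows "\<mu> (A - B) = \<mu> A - \<mu> B"
  using fin_signed_measure_Un[of M \<mu> B "A - B"] assms
  by (simp add: Un_absorb1)

lemma pos_var_upper:
  "B \<in> sets M \<Longrightarrow> B \<subseteq> A \<Longrightarrow> ennreal (\<mu> B) \<le> pos_var M \<mu> A"
  unfolding pos_var_def by (rule SUP_upper) auto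

lemma pos_var_least:
  "(\<And>B. B \<in> sets M \<Longrightarrow> B \<subseteq> A \<Longrightarrow> ennreal (\<mu> B) \<le> c) \<Longrightarrow> pos_var M \<mu> A \<le> c"
  unfolding pos_var_def by (rule SUP_least) auto

lemma pos_var_mono: "A \<subseteq> B \<Longrightarrow> pos_var M \<mu> A \<le> pos_var M \<mu> B"
  by (auto intro!: pos_var_least pos_var_upper)

lemma pos_var_empty:
  assumes "fin_signed_measure M \<mu>"
  shows "pos_var M \<mu> {} = 0"
proof -
  have "pos_var M \<mu> {} \<le> 0"
    by (rule pos_var_least) (simp add: fin_signed_measure_empty[OF assms])
  then show ?thesis by simp
qed

text \<open>Subsets of the two disjoint sets unite to a subset of the union, on which \<mu> adds up.
  When one of the two values is negative it is truncated to 0, and the other subset alone already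
  competes in the supremum.\<close>

lemma pos_var_superadditive:
  assumes \<mu>: "fin_signed_measure M \<mu>" and "A \<inter> B = {}"
  shows "pos_var M \<mu> A + pos_var M \<mu> B \<le> pos_var M \<mu> (A \<union> B)"
proof -
  have ne: "{B \<in> sets M. B \<subseteq> X} \<noteq> {}" for X by auto
  have *: "ennreal (\<mu> C) + ennreal (\<mu> D) \<le> pos_var M \<mu> (A \<union> B)"
    if "C \<in> sets M" "C \<subseteq> A" "D \<in> sets M" "D \<subseteq> B" for C D
  proof -
    have "C \<inter> D = {}" using that assms by auto
    then have Un: "\<mu> (C \<union> D) = \<mu> C + \<mu> D"
      using that by (intro fin_signed_measure_Un[OF \<mu>]) auto
    have "ennreal (\<mu> C) \<le> pos_var M \<mu> (A \<union> B)" "ennreal (\<mu> D) \<le> pos_var M \<mu> (A \<union> B)"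
      "ennreal (\<mu> (C \<union> D)) \<le> pos_var M \<mu> (A \<union> B)"
      using that by (auto intro!: pos_var_upper)
    then show ?thesis
      unfolding Un
      by (cases "\<mu> C \<ge> 0"; cases "\<mu> D \<ge> 0") (auto simp: ennreal_neg)
  qed
  show ?thesis
    unfolding pos_var_def[of M \<mu> A] pos_var_def[of M \<mu> B]
      ennreal_SUP_add_left[OF ne, symmetric] ennreal_SUP_add_right[OF ne]
    by (intro SUP_least) (use * in auto)
qed

text \<open>Superadditivity on finite unions bounds the partial sums from above. Conversely, any
  competitor \<open>B\<close> inside the union splits into the pieces \<open>B \<inter> A i\<close>,
  each a competitor for \<open>A i\<close>.\<close>

lemma pos_var_countably_additive:
  assumes \<mu>: "fin_signed_measure M \<mu>"
  shows "countably_additive (sets M) (pos_var M \<mu>)"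
proof (rule countably_additiveI)
  fix A :: "nat \<Rightarrow> 'a set"
  assume A: "range A \<subseteq> sets M" "disjoint_family A" "(\<Union>i. A i) \<in> sets M"
  show "(\<Sum>i. pos_var M \<mu> (A i)) = pos_var M \<mu> (\<Union>i. A i)"
  proof (rule antisym)
    have part: "(\<Sum>i<n. pos_var M \<mu> (A i)) \<le> pos_var M \<mu> (\<Union>i<n. A i)" for n
    proof (induction n)
      case (Suc n)
      have "(\<Sum>i<Suc n. pos_var M \<mu> (A i)) \<le> pos_var M \<mu> (\<Union>i<n. A i) + pos_var M \<mu> (A n)"
        using Suc by (simp add: add_right_mono)
      also have "\<dots> \<le> pos_var M \<mu> ((\<Union>i<n. A i) \<union> A n)"
        using A(2) by (intro pos_var_superadditive[OF \<mu>])
          (auto simp: disjoint_family_on_def dest: less_imp_neq)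
      also have "(\<Union>i<n. A i) \<union> A n = (\<Union>i<Suc n. A i)"
        by (auto simp: lessThan_Suc)
      finally show ?case .
    qed simp
    show "(\<Sum>i. pos_var M \<mu> (A i)) \<le> pos_var M \<mu> (\<Union>i. A i)"
      by (intro suminf_le_const order_trans[OF part] pos_var_mono) auto
  next
    show "pos_var M \<mu> (\<Union>i. A i) \<le> (\<Sum>i. pos_var M \<mu> (A i))"
    proof (rule pos_var_least)
      fix B assume B: "B \<in> sets M" "B \<subseteq> (\<Union>i. A i)"
      have "(\<lambda>i. \<mu> (B \<inter> A i)) sums \<mu> (\<Union>i. B \<inter> A i)"
        using A B by (intro fin_signed_measure_sums[OF \<mu>]) (auto simp: disjoint_family_on_def)
      moreover have "(\<Union>i. B \<inter> A i) = B" using B by auto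
      ultimately have "ennreal (\<mu> B) \<le> (\<Sum>i. ennreal (\<mu> (B \<inter> A i)))"
        by (metis ennreal_le_suminf_of_sums)
      also have "\<dots> \<le> (\<Sum>i. pos_var M \<mu> (A i))"
        using A B by (intro suminf_le pos_var_upper) auto
      finally show "ennreal (\<mu> B) \<le> (\<Sum>i. pos_var M \<mu> (A i))" .
    qed
  qed
qed

text \<open>The positive part of the Jordan decomposition. The negative part is the same
  construction for \<open>\<lambda>A. - \<mu> A\<close>, by \<open>neg_var_eq_pos_var\<close>, so
  every fact is proved only once for both parts.\<close>

definition pos_measure :: "'a measure \<Rightarrow> ('a set \<Rightarrow> real) \<Rightarrow> 'a measure" where
  "pos_measure M \<mu> = measure_of (space M) (sets M) (pos_var M \<mu>)"

lemma sets_pos_measure [measurable_cong, simp]: "sets (pos_measure M \<mu>) = sets M"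
  by (simp add: pos_measure_def)

lemma space_pos_measure [simp]: "space (pos_measure M \<mu>) = space M"
  by (simp add: pos_measure_def)

lemma emeasure_pos_measure:
  assumes "fin_signed_measure M \<mu>" "A \<in> sets M"
  shows "emeasure (pos_measure M \<mu>) A = pos_var M \<mu> A"
  unfolding pos_measure_def using assms
  by (intro emeasure_measure_of_sigma sets.sigma_algebra_axioms pos_var_countably_additive)
    (auto simp: positive_def pos_var_empty)

section \<open>Finiteness of the total variation and the Jordan decomposition\<close>

lemma tot_var_Un:
  assumes "fin_signed_measure M \<mu>" "A \<in> sets M" "B \<in> sets M" "A \<inter> B = {}"
  shows "tot_var M \<mu> (A \<union> B) = tot_var M \<mu> A + tot_var M \<mu> B"
proof -
  have "pos_var M \<nu> (A \<union> B) = pos_var M \<nu> A + pos_var M \<nu> B" if "fin_signed_measure M \<nu>" for \<nu>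
    using plus_emeasure[of A "pos_measure M \<nu>" B] assms that
    by (simp add: emeasure_pos_measure)
  then show ?thesis
    using assms fin_signed_measure_uminus[of M \<mu>]
    by (simp add: tot_var_def neg_var_eq_pos_var ac_simps)
qed

text \<open>A set of infinite variation splits into two parts on which \<open>\<mu>\<close> is at least 1 in modulus,
  one of them again of infinite variation; iterating this contradicts countable additivity.\<close>

lemma tot_var_space_finite:
  assumes \<mu>: "fin_signed_measure M \<mu>"
  shows "tot_var M \<mu> (space M) < \<infinity>"
proof (rule ccontr)
  assume "\<not> ?thesis"
  then have inf: "tot_var M \<mu> (space M) = \<infinity>" by (simp add: less_top[symmetric])
  have split: "\<exists>F. (F \<in> sets M \<and> tot_var M \<mu> F = \<infinity>) \<and> F \<subseteq> E \<and> \<bar>\<mu> (E - F)\<bar> \<ge> 1"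
    if E: "E \<in> sets M" "tot_var M \<mu> E = \<infinity>" for E
  proof -
    \<comment> \<open>The margin \<open>\<bar>\<mu> E\<bar> + 1\<close> makes both \<open>A\<close>
      and \<open>E - A\<close> have \<mu>-value at least 1 in modulus, so either of them may be the
      part that is removed.\<close>
    obtain A where A: "A \<in> sets M" "A \<subseteq> E" "\<bar>\<mu> A\<bar> \<ge> \<bar>\<mu> E\<bar> + 1"
    proof -
      have "pos_var M \<mu> E = \<infinity> \<or> neg_var M \<mu> E = \<infinity>"
        using E by (auto simp: tot_var_def)
      then obtain \<nu> where \<nu>: "pos_var M \<nu> E = \<infinity>" "\<And>A. \<bar>\<nu> A\<bar> = \<bar>\<mu> A\<bar>"
        by (metis neg_var_eq_pos_var abs_minus_cancel)
      have "ennreal (\<bar>\<mu> E\<bar> + 1) < pos_var M \<nu> E" using \<nu> by simp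
      then obtain A where "A \<in> sets M" "A \<subseteq> E" "ennreal (\<bar>\<mu> E\<bar> + 1) < ennreal (\<nu> A)"
        by (auto simp: pos_var_def less_SUP_iff)
      then show ?thesis
        using that[of A] \<nu>(2)[of A]
        by (metis abs_ge_self ennreal_leI leD le_less_linear less_imp_le order_trans)
    qed
    have D: "\<mu> (E - A) = \<mu> E - \<mu> A"
      using A E by (intro fin_signed_measure_Diff[OF \<mu>])
    have "tot_var M \<mu> A + tot_var M \<mu> (E - A) = \<infinity>"
      using tot_var_Un[OF \<mu>, of A "E - A"] A E by (simp add: Un_absorb1)
    then consider "tot_var M \<mu> A = \<infinity>" | "tot_var M \<mu> (E - A) = \<infinity>"
      by auto
    then show ?thesis
    proof cases
      case 1
      then show ?thesis using A D by (intro exI[of _ A]) auto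
    next
      case 2
      then show ?thesis using A D E by (intro exI[of _ "E - A"]) (auto simp: double_diff)
    qed
  qed
  obtain E where E: "\<And>n. E n \<in> sets M" "\<And>n. E (Suc n) \<subseteq> E n" "\<And>n. \<bar>\<mu> (E n - E (Suc n))\<bar> \<ge> 1"
    using dependent_nat_choice[of "\<lambda>_ E. E \<in> sets M \<and> tot_var M \<mu> E = \<infinity>"
        "\<lambda>_ E F. F \<subseteq> E \<and> \<bar>\<mu> (E - F)\<bar> \<ge> 1"] split inf
    by (metis sets.top)
  have dec: "E n \<subseteq> E m" if "m \<le> n" for m n
    using that E(2) by (rule lift_Suc_antimono_le[rotated])
  have "disjoint_family (\<lambda>n. E n - E (Suc n))"
    unfolding disjoint_family_on_def
  proof (intro ballI impI)
    fix m n :: nat assume "m \<noteq> n"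
    then show "(E m - E (Suc m)) \<inter> (E n - E (Suc n)) = {}"
      using dec[of "Suc m" n] dec[of "Suc n" m] by (cases "m < n") auto
  qed
  then have "(\<lambda>n. \<mu> (E n - E (Suc n))) sums \<mu> (\<Union>n. E n - E (Suc n))"
    using E by (intro fin_signed_measure_sums[OF \<mu>]) auto
  then have "(\<lambda>n. \<mu> (E n - E (Suc n))) \<longlonglongrightarrow> 0"
    by (intro summable_LIMSEQ_zero) (rule sums_summable)
  then have "eventually (\<lambda>n. \<bar>\<mu> (E n - E (Suc n))\<bar> < 1) sequentially"
    by (auto dest!: tendstoD[of _ _ _ 1] simp: dist_real_def)
  then obtain n where "\<bar>\<mu> (E n - E (Suc n))\<bar> < 1"
    by (auto simp: eventually_sequentially)
  with E(3)[of n] show False by simp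
qed

lemma finite_measure_pos_measure:
  assumes "fin_signed_measure M \<mu>"
  shows "finite_measure (pos_measure M \<mu>)"
  using tot_var_space_finite[OF assms] assms
  by (intro finite_measureI) (auto simp: emeasure_pos_measure tot_var_def)

text \<open>For \<open>B \<subseteq> A\<close> the value on \<open>B\<close> is the value on
  \<open>A\<close> minus that on \<open>A - B\<close>, hence at most the value on \<open>A\<close>
  plus the negative variation. The supremum over \<open>B\<close> gives one inequality, and the same
  argument for \<open>- \<mu>\<close> gives the other; finite variations allow the
  subtraction.\<close>

lemma jordan_decomposition:
  assumes \<mu>: "fin_signed_measure M \<mu>" and A: "A \<in> sets M"
  shows "\<mu> A = measure (pos_measure M \<mu>) A - measure (pos_measure M (\<lambda>A. - \<mu> A)) A"
proof -
  interpret p: finite_measure "pos_measure M \<mu>"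
    by (rule finite_measure_pos_measure[OF \<mu>])
  interpret n: finite_measure "pos_measure M (\<lambda>A. - \<mu> A)"
    by (rule finite_measure_pos_measure[OF fin_signed_measure_uminus[OF \<mu>]])
  have le: "measure (pos_measure M \<nu>) A \<le> \<nu> A + measure (pos_measure M (\<lambda>A. - \<nu> A)) A"
    if \<nu>: "fin_signed_measure M \<nu>" for \<nu>
  proof -
    interpret p: finite_measure "pos_measure M \<nu>"
      by (rule finite_measure_pos_measure[OF \<nu>])
    interpret n: finite_measure "pos_measure M (\<lambda>A. - \<nu> A)"
      by (rule finite_measure_pos_measure[OF fin_signed_measure_uminus[OF \<nu>]])
    have bd: "- \<nu> B \<le> measure (pos_measure M (\<lambda>A. - \<nu> A)) A" if "B \<in> sets M" "B \<subseteq> A" for B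
      using pos_var_upper[of B M A "\<lambda>A. - \<nu> A"] that A fin_signed_measure_uminus[OF \<nu>]
      by (simp add: n.emeasure_eq_measure flip: emeasure_pos_measure)
    have "\<nu> B \<le> \<nu> A + measure (pos_measure M (\<lambda>A. - \<nu> A)) A"
      if "B \<in> sets M" "B \<subseteq> A" for B
      using bd[of "A - B"] that A fin_signed_measure_Diff[OF \<nu> A that] by auto
    \<comment> \<open>Nonnegativity ensures that \<open>ennreal\<close> does not truncate the bound,
      so that it can be read back as an inequality of reals.\<close>
    moreover have "0 \<le> \<nu> A + measure (pos_measure M (\<lambda>A. - \<nu> A)) A"
      using bd[of A] A by auto
    ultimately have "pos_var M \<nu> A \<le> ennreal (\<nu> A + measure (pos_measure M (\<lambda>A. - \<nu> A)) A)"
      by (intro pos_var_least) (auto intro!: ennreal_leI)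
    then show ?thesis
      using \<open>0 \<le> \<nu> A + _\<close> A \<nu>
      by (simp add: p.emeasure_eq_measure flip: emeasure_pos_measure)
  qed
  show ?thesis
    using le[OF \<mu>] le[OF fin_signed_measure_uminus[OF \<mu>]] by simp
qed

section \<open>Measures with an integrable density\<close>

text \<open>The signed measure \<open>g dP\<close>. The value 0 off the sigma-algebra matches the
  convention of \<open>fin_signed_measure\<close>, so that representations by densities are
  equalities of functions on all sets.\<close>

definition signed_density :: "'a measure \<Rightarrow> ('a \<Rightarrow> real) \<Rightarrow> 'a set \<Rightarrow> real" where
  "signed_density P g A = (if A \<in> sets P then LINT x:A|P. g x else 0)"

lemma signed_density_linear:
  assumes "integrable P g" "integrable P h"
  shows "signed_density P (\<lambda>x. a * g x + b * h x) =
    (\<lambda>A. a * signed_density P g A + b * signed_density P h A)"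
proof
  fix A
  have "set_integrable P A g" "set_integrable P A h" if "A \<in> sets P"
    using assms that by (auto simp: set_integrable_def intro!: integrable_mult_indicator
        simp del: real_scaleR_def)
  then show "signed_density P (\<lambda>x. a * g x + b * h x) A =
      a * signed_density P g A + b * signed_density P h A"
    by (simp add: signed_density_def)
qed

lemma signed_density_uminus:
  "signed_density P (\<lambda>x. - g x) = (\<lambda>A. - signed_density P g A)"
  by (auto simp: signed_density_def set_lebesgue_integral_def fun_eq_iff)

text \<open>Partial sums are integrals over the increasing finite unions, and integrability of
  \<open>g\<close> makes the set integral continuous along them.\<close>

lemma fin_signed_measure_signed_density:
  assumes g: "integrable P g" and sets: "sets P = sets M"
  shows "fin_signed_measure M (signed_density P g)"
  unfolding fin_signed_measure_def
proof (intro conjI allI impI)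
  fix A :: "nat \<Rightarrow> 'a set"
  assume A: "range A \<subseteq> sets M" "disjoint_family A"
  have int: "set_integrable P X g" if "X \<in> sets P" for X
    using g that by (auto simp: set_integrable_def intro!: integrable_mult_indicator
        simp del: real_scaleR_def)
  have A': "A i \<in> sets P" for i using A sets by auto
  have "(\<lambda>n. LINT x:(\<Union>i<n. A i)|P. g x) \<longlonglongrightarrow> (LINT x:(\<Union>n. \<Union>i<n. A i)|P. g x)"
    using A' by (intro set_integral_cont_up int) (auto simp: incseq_def, force)
  moreover have "(\<Union>n. \<Union>i<n. A i) = (\<Union>n. A n)" by auto
  moreover have "(LINT x:(\<Union>i<n. A i)|P. g x) = (\<Sum>i<n. LINT x:A i|P. g x)" for n
    using A' A(2) by (intro set_integral_finite_UN_AE AE_I2 int)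
      (auto simp: disjoint_family_on_def)
  ultimately show "(\<lambda>n. signed_density P g (A n)) sums signed_density P g (\<Union>n. A n)"
    using A' by (simp add: signed_density_def sums_def)
qed (simp add: signed_density_def sets)

lemma ennreal_integral_le_nn_integral:
  fixes f :: "'a \<Rightarrow> real"
  assumes "integrable P f"
  shows "ennreal (\<integral>x. f x \<partial>P) \<le> (\<integral>\<^sup>+x. ennreal (f x) \<partial>P)"
proof -
  have "ennreal (\<integral>x. f x \<partial>P) \<le> ennreal (\<integral>x. max 0 (f x) \<partial>P)"
    using assms by (intro ennreal_leI integral_mono) auto
  also have "\<dots> = (\<integral>\<^sup>+x. ennreal (max 0 (f x)) \<partial>P)"
    using assms by (intro nn_integral_eq_integral[symmetric]) auto
  finally show ?thesis by (simp add: ennreal_max_0)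
qed

text \<open>The supremum is attained at \<open>A \<inter> {g \<ge> 0}\<close>, the positive half of
  a Hahn decomposition for \<open>g dP\<close>; on any other subset the integral of \<open>g\<close>
  is at most that of its positive part over \<open>A\<close>.\<close>

lemma pos_var_signed_density:
  assumes g: "integrable P g" and sets [measurable_cong]: "sets P = sets M"
    and A: "A \<in> sets M"
  shows "pos_var M (signed_density P g) A = (\<integral>\<^sup>+x\<in>A. ennreal (g x) \<partial>P)"
proof -
  have ind: "ennreal (indicator B x * g x) = ennreal (g x) * indicator B x" for B x
    by (auto split: split_indicator)
  have int: "integrable P (\<lambda>x. indicator B x * g x)" if "B \<in> sets M" for B
    using integrable_mult_indicator[of B P g] g that sets by simp
  have le: "ennreal (signed_density P g B) \<le> (\<integral>\<^sup>+x\<in>B. ennreal (g x) \<partial>P)" if "B \<in> sets M" for B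
    using ennreal_integral_le_nn_integral[OF int[OF that]] that sets
    by (simp add: signed_density_def set_lebesgue_integral_def ind)
  have upper: "pos_var M (signed_density P g) A \<le> (\<integral>\<^sup>+x\<in>A. ennreal (g x) \<partial>P)"
    by (rule pos_var_least, rule order_trans[OF le])
      (auto intro!: nn_integral_mono split: split_indicator)
  define B where "B = A \<inter> {x \<in> space M. g x \<ge> 0}"
  have "g \<in> borel_measurable M"
    using borel_measurable_integrable[OF g] measurable_cong_sets[OF sets refl] by blast
  then have B: "B \<in> sets M"
    using A unfolding B_def by (intro sets.Int) auto
  have "(\<integral>\<^sup>+x\<in>A. ennreal (g x) \<partial>P) = (\<integral>\<^sup>+x. ennreal (indicator B x * g x) \<partial>P)"
    using sets.sets_into_space[OF A]
    by (intro nn_integral_cong) (auto simp: B_def ennreal_neg split: split_indicator)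
  also have "\<dots> = ennreal (\<integral>x. indicator B x * g x \<partial>P)"
    by (intro nn_integral_eq_integral int B AE_I2) (auto simp: B_def split: split_indicator)
  also have "\<dots> = ennreal (signed_density P g B)"
    using sets B by (simp add: signed_density_def set_lebesgue_integral_def)
  also have "\<dots> \<le> pos_var M (signed_density P g) A"
    by (intro pos_var_upper B) (auto simp: B_def)
  finally have "(\<integral>\<^sup>+x\<in>A. ennreal (g x) \<partial>P) \<le> pos_var M (signed_density P g) A"
    .
  with upper show ?thesis by (rule antisym)
qed

lemma tot_var_signed_density:
  assumes g: "integrable P g" and sets: "sets P = sets M" and A: "A \<in> sets M"
  shows "tot_var M (signed_density P g) A = (\<integral>\<^sup>+x\<in>A. ennreal \<bar>g x\<bar> \<partial>P)"
proof -
  have A': "A \<in> sets P" using A sets by simp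
  have "tot_var M (signed_density P g) A =
      (\<integral>\<^sup>+x\<in>A. ennreal (g x) \<partial>P) + (\<integral>\<^sup>+x\<in>A. ennreal (- g x) \<partial>P)"
    using pos_var_signed_density[OF g sets A] pos_var_signed_density[of P "\<lambda>x. - g x" M A] g sets A
    by (simp add: tot_var_def neg_var_eq_pos_var signed_density_uminus)
  also have "\<dots> = (\<integral>\<^sup>+x. ennreal (g x) * indicator A x + ennreal (- g x) * indicator A x \<partial>P)"
    using A' g by (intro nn_integral_add[symmetric]) auto
  also have "\<dots> = (\<integral>\<^sup>+x\<in>A. ennreal \<bar>g x\<bar> \<partial>P)"
    by (intro nn_integral_cong) (auto simp: abs_real_def ennreal_neg split: split_indicator)
  finally show ?thesis .
qed

text \<open>Hence \<open>g \<mapsto> g dP\<close> is an isometry from the integrable functions into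
  the signed measures, which turns total variation bounds on functionals into \<open>L^1\<close>
  bounds.\<close>

lemma tv_norm_signed_density:
  assumes g: "integrable P g" and sets: "sets P = sets M"
  shows "tv_norm M (signed_density P g) = (\<integral>x. \<bar>g x\<bar> \<partial>P)"
proof -
  have "tot_var M (signed_density P g) (space M) = (\<integral>\<^sup>+x. ennreal \<bar>g x\<bar> \<partial>P)"
    unfolding tot_var_signed_density[OF g sets sets.top]
    unfolding sets_eq_imp_space_eq[OF sets, symmetric]
    by (rule nn_set_integral_space)
  also have "\<dots> = ennreal (\<integral>x. \<bar>g x\<bar> \<partial>P)"
    using g by (intro nn_integral_eq_integral) auto
  finally show ?thesis by (simp add: tv_norm_def)
qed

text \<open>The density is written with \<open>max 0\<close> because \<open>integral_density\<close>
  asks for a real density that is nonnegative before the coercion to \<open>ennreal\<close>.\<close>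

lemma pos_measure_signed_density:
  assumes g: "integrable P g" and sets: "sets P = sets M"
  shows "pos_measure M (signed_density P g) = density P (\<lambda>x. ennreal (max 0 (g x)))"
proof (rule measure_eqI)
  fix A assume "A \<in> sets (pos_measure M (signed_density P g))"
  then have "A \<in> sets M" "A \<in> sets P" using sets by auto
  then show "emeasure (pos_measure M (signed_density P g)) A =
      emeasure (density P (\<lambda>x. ennreal (max 0 (g x)))) A"
    using g sets by (simp add: emeasure_pos_measure fin_signed_measure_signed_density
        pos_var_signed_density emeasure_density ennreal_max_0)
qed (simp add: sets)

lemma integrable_bounded_mult:
  fixes f g :: "'a \<Rightarrow> real"
  assumes g: "integrable P g" and f [measurable]: "f \<in> borel_measurable P"
    and K: "AE x in P. \<bar>f x\<bar> \<le> K"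
  shows "integrable P (\<lambda>x. f x * g x)"
proof (rule Bochner_Integration.integrable_bound)
  show "integrable P (\<lambda>x. K * g x)" using g by simp
  show "AE x in P. norm (f x * g x) \<le> norm (K * g x)"
    using K by eventually_elim (simp add: abs_mult mult_right_mono)
qed (use g in measurable)

text \<open>The Jordan parts of \<open>g dP\<close> have densities \<open>g^+\<close> and
  \<open>g^-\<close>. Boundedness of \<open>f\<close> makes both products integrable, so the two
  integrals recombine into one.\<close>

lemma signed_integral_signed_density:
  assumes g: "integrable P g" and sets [measurable_cong]: "sets P = sets M"
    and f [measurable]: "f \<in> borel_measurable M" and K: "AE x in P. \<bar>f x\<bar> \<le> K"
  shows "signed_integral M (signed_density P g) f = (\<integral>x. f x * g x \<partial>P)"
proof -
  note [measurable] = borel_measurable_integrable[OF g]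
  have [measurable]: "f \<in> borel_measurable P"
    using f measurable_cong_sets[OF sets refl] by blast
  have pos: "(\<integral>x. f x \<partial>pos_measure M (signed_density P h)) = (\<integral>x. f x * max 0 (h x) \<partial>P)"
    if h [measurable]: "integrable P h" for h
    unfolding pos_measure_signed_density[OF h sets]
    by (subst integral_density) (auto simp: mult.commute intro: borel_measurable_integrable[OF h])
  have "signed_integral M (signed_density P g) f =
      (\<integral>x. f x \<partial>pos_measure M (signed_density P g)) -
      (\<integral>x. f x \<partial>pos_measure M (signed_density P (\<lambda>x. - g x)))"
    by (simp add: signed_integral_def pos_measure_def neg_var_eq_pos_var signed_density_uminus)
  also have "\<dots> = (\<integral>x. f x * max 0 (g x) \<partial>P) - (\<integral>x. f x * max 0 (- g x) \<partial>P)"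
    using g by (simp add: pos)
  also have "\<dots> = (\<integral>x. f x * max 0 (g x) - f x * max 0 (- g x) \<partial>P)"
    using g K by (intro Bochner_Integration.integral_diff[symmetric] integrable_bounded_mult) auto
  also have "\<dots> = (\<integral>x. f x * g x \<partial>P)"
    by (intro Bochner_Integration.integral_cong) (auto simp: max_def)
  finally show ?thesis .
qed

section \<open>Radon-Nikodym for signed measures and the dual of \<open>L^1\<close>\<close>

lemma (in finite_measure) finite_absolutely_continuous_density:
  assumes "finite_measure N" "absolutely_continuous M N" and sets: "sets N = sets M"
  obtains D where "integrable M D" "\<And>A. A \<in> sets M \<Longrightarrow> measure N A = (LINT x:A|M. D x)"
proof -
  interpret N: finite_measure N by fact
  \<comment> \<open>\<open>RN_deriv\<close> takes values in \<open>ennreal\<close>; since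
    \<open>N\<close> is finite it agrees almost everywhere with a nonnegative real function.\<close>
  obtain D where D [measurable]: "D \<in> borel_measurable M"
    and RN: "AE x in M. RN_deriv M N x = ennreal (D x)" and D0: "\<And>x. 0 \<le> D x"
    using real_RN_deriv[OF assms] by metis
  have dens: "emeasure N A = (\<integral>\<^sup>+x\<in>A. ennreal (D x) \<partial>M)" if "A \<in> sets M" for A
  proof -
    have "N = density M (RN_deriv M N)"
      by (rule density_RN_deriv[OF assms(2,3), symmetric])
    also have "\<dots> = density M (\<lambda>x. ennreal (D x))"
      using RN by (intro density_cong) auto
    finally have "N = density M (\<lambda>x. ennreal (D x))" .
    then show ?thesis using that by (simp add: emeasure_density)
  qed
  show ?thesis
  proof
    have "(\<integral>\<^sup>+x. ennreal (D x) \<partial>M) = emeasure N (space M)"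
      by (subst dens) auto
    also have "\<dots> < \<infinity>" by (simp add: N.emeasure_eq_measure)
    finally show "integrable M D"
      using D0 by (intro integrableI_bounded) auto
    fix A assume A [measurable]: "A \<in> sets M"
    have "measure N A = enn2real (\<integral>\<^sup>+x. ennreal (indicator A x * D x) \<partial>M)"
      unfolding measure_def dens[OF A]
      by (intro arg_cong[where f = enn2real] nn_integral_cong) (auto split: split_indicator)
    also have "\<dots> = (LINT x:A|M. D x)"
      unfolding set_lebesgue_integral_def using D0
      by (subst integral_eq_nn_integral) auto
    finally show "measure N A = (LINT x:A|M. D x)" .
  qed
qed

text \<open>Both Jordan parts lie below the total variation, so both inherit absolute continuity;
  the density is the difference of their Radon-Nikodym derivatives.\<close>

lemma signed_radon_nikodym:
  assumes P: "finite_measure P" and sets: "sets P = sets M" and \<mu>: "fin_signed_measure M \<mu>"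
    and ac: "\<And>N. N \<in> sets M \<Longrightarrow> emeasure P N = 0 \<Longrightarrow> tot_var M \<mu> N = 0"
  obtains g where "integrable P g" "\<mu> = signed_density P g"
proof -
  interpret finite_measure P by fact
  have ac': "absolutely_continuous P (pos_measure M \<nu>)"
    if \<nu>: "fin_signed_measure M \<nu>" and le: "\<And>A. pos_var M \<nu> A \<le> tot_var M \<mu> A" for \<nu>
    unfolding absolutely_continuous_def
  proof
    fix N assume "N \<in> null_sets P"
    then have N: "N \<in> sets M" "emeasure P N = 0" using sets by auto
    then have "emeasure (pos_measure M \<nu>) N = 0"
      using ac[OF N] le[of N] by (simp add: emeasure_pos_measure \<nu>)
    then show "N \<in> null_sets (pos_measure M \<nu>)" using N by auto
  qed
  obtain D where
    D: "integrable P D" "\<And>A. A \<in> sets P \<Longrightarrow> measure (pos_measure M \<mu>) A = (LINT x:A|P. D x)"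
    by (rule finite_absolutely_continuous_density[OF finite_measure_pos_measure[OF \<mu>] ac'[OF \<mu>]])
      (simp_all add: sets tot_var_def neg_var_eq_pos_var)
  obtain E where
    E: "integrable P E" "\<And>A. A \<in> sets P \<Longrightarrow> measure (pos_measure M (\<lambda>A. - \<mu> A)) A = (LINT x:A|P. E x)"
    by (rule finite_absolutely_continuous_density[OF
          finite_measure_pos_measure[OF fin_signed_measure_uminus[OF \<mu>]] ac'[OF fin_signed_measure_uminus[OF \<mu>]]])
      (simp_all add: sets tot_var_def neg_var_eq_pos_var)
  show ?thesis
  proof
    \<comment> \<open>The difference is written as a linear combination to fit
      \<open>signed_density_linear\<close>.\<close>
    show "integrable P (\<lambda>x. 1 * D x + (-1) * E x)" using D E by auto
    show "\<mu> = signed_density P (\<lambda>x. 1 * D x + (-1) * E x)"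
    proof
      fix A show "\<mu> A = signed_density P (\<lambda>x. 1 * D x + (-1) * E x) A"
      proof (cases "A \<in> sets M")
        case True
        then show ?thesis
          unfolding signed_density_linear[OF D(1) E(1)]
          using jordan_decomposition[OF \<mu> True] D(2)[of A] E(2)[of A] sets True
          by (simp add: signed_density_def)
      next
        case False
        then show ?thesis using \<mu> sets by (simp add: signed_density_def fin_signed_measure_def)
      qed
    qed
  qed
qed

text \<open>The function \<open>K - f\<close> has nonnegative integral over every set and so is
  nonnegative almost everywhere. This converts bounds tested on sets into pointwise bounds.\<close>

lemma (in finite_measure) AE_le_of_set_integral_le:
  assumes f: "integrable M f"
    and le: "\<And>A. A \<in> sets M \<Longrightarrow> (LINT x:A|M. f x) \<le> K * measure M A"
  shows "AE x in M. f x \<le> K"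
proof -
  have "AE x in M. 0 \<le> K - f x"
  proof (rule density_nonneg)
    fix A assume A: "A \<in> sets M"
    have "set_integrable M A f" "set_integrable M A (\<lambda>_. K)"
      using f A by (auto simp: set_integrable_def intro!: integrable_mult_indicator
          simp del: real_scaleR_def)
    then have "(LINT x:A|M. K - f x) = K * measure M A - (LINT x:A|M. f x)"
      using A sets.sets_into_space[OF A]
      by (simp add: set_integral_diff) (simp add: set_lebesgue_integral_def Int_absorb2)
    then show "0 \<le> (LINT x:A|M. K - f x)" using le[OF A] by simp
  qed (use f in auto)
  then show ?thesis by eventually_elim simp
qed

text \<open>The set function \<open>A \<mapsto> \<Phi> (indicator A)\<close> is a finite signed
  measure bounded by \<open>K\<close> times the measure, so it has a density \<open>f\<close> with
  \<open>\<bar>f\<bar> \<le> K\<close>. The representation holds on indicators and extends by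
  linearity and dominated limits.\<close>

lemma (in finite_measure) L1_dual_representation:
  fixes \<Phi> :: "('a \<Rightarrow> real) \<Rightarrow> real"
  assumes lin: "\<And>g h a b. integrable M g \<Longrightarrow> integrable M h \<Longrightarrow>
      \<Phi> (\<lambda>x. a * g x + b * h x) = a * \<Phi> g + b * \<Phi> h"
    and bdd: "\<And>g. integrable M g \<Longrightarrow> \<bar>\<Phi> g\<bar> \<le> K * (\<integral>x. \<bar>g x\<bar> \<partial>M)"
  obtains f where "f \<in> borel_measurable M" "AE x in M. \<bar>f x\<bar> \<le> K"
    "\<And>g. integrable M g \<Longrightarrow> \<Phi> g = (\<integral>x. f x * g x \<partial>M)"
proof -
  \<comment> \<open>Dominated pointwise convergence implies convergence in \<open>L^1\<close>, along
    which \<Phi> is continuous. This serves both the countable additivity of \<nu> and the limit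
    case of the final induction.\<close>
  have cont: "(\<lambda>i. \<Phi> (s i)) \<longlonglongrightarrow> \<Phi> g"
    if s: "\<And>i. integrable M (s i)" and g: "integrable M g" and w: "integrable M w"
      and lim: "\<And>x. x \<in> space M \<Longrightarrow> (\<lambda>i. s i x) \<longlonglongrightarrow> g x"
      and dom: "\<And>i x. x \<in> space M \<Longrightarrow> \<bar>s i x\<bar> \<le> w x" for s g w
  proof -
    note [measurable] = borel_measurable_integrable[OF s] borel_measurable_integrable[OF g]
    have "(\<lambda>i. \<integral>x. \<bar>s i x - g x\<bar> \<partial>M) \<longlonglongrightarrow> (\<integral>x. 0 \<partial>M)"
    proof (rule integral_dominated_convergence[where w = "\<lambda>x. w x + \<bar>g x\<bar>"])
      show "AE x in M. (\<lambda>i. \<bar>s i x - g x\<bar>) \<longlonglongrightarrow> 0"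
        using lim by (intro AE_I2 tendsto_rabs_zero LIM_zero)
      show "AE x in M. norm \<bar>s i x - g x\<bar> \<le> w x + \<bar>g x\<bar>" for i
        using dom[of _ i] by (intro AE_I2) (smt (verit) real_norm_def)
    qed (use g w in auto)
    then have "(\<lambda>i. K * (\<integral>x. \<bar>s i x - g x\<bar> \<partial>M)) \<longlonglongrightarrow> K * 0"
      by (intro tendsto_mult_left) simp
    moreover have dist: "norm (\<Phi> (s i) - \<Phi> g) \<le> K * (\<integral>x. \<bar>s i x - g x\<bar> \<partial>M)" for i
      using bdd[of "\<lambda>x. s i x - g x"] lin[OF s[of i] g, of 1 "-1"] s g by simp
    ultimately have "(\<lambda>i. \<Phi> (s i) - \<Phi> g) \<longlonglongrightarrow> 0"
      using Lim_null_comparison[OF always_eventually[OF allI[OF dist]]] by simp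
    then show ?thesis by (rule LIM_zero_cancel)
  qed
  have \<Phi>_add: "\<Phi> (\<lambda>x. g x + h x) = \<Phi> g + \<Phi> h" if "integrable M g" "integrable M h" for g h
    using lin[OF that, of 1 1] by simp
  have scale: "\<Phi> (\<lambda>x. a * g x) = a * \<Phi> g" if "integrable M g" for a g
    using lin[OF that that, of a 0] by simp
  define \<nu> where "\<nu> A = (if A \<in> sets M then \<Phi> (indicator A) else 0)" for A
  have ind: "integrable M (indicator A :: _ \<Rightarrow> real)" if "A \<in> sets M" for A
    using that by (simp add: integrable_indicator_iff emeasure_eq_measure)
  have \<nu>_bdd: "\<bar>\<nu> A\<bar> \<le> K * measure M A" if A: "A \<in> sets M" for A
    using bdd[OF ind[OF A]] A sets.sets_into_space[OF A] by (simp add: \<nu>_def Int_absorb2)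
  have \<nu>: "fin_signed_measure M \<nu>"
    unfolding fin_signed_measure_def
  proof (intro conjI allI impI)
    fix A :: "nat \<Rightarrow> 'a set"
    assume A: "range A \<subseteq> sets M" "disjoint_family A"
    then have A': "A i \<in> sets M" for i by auto
    have "(\<Sum>i<n. \<nu> (A i)) = \<Phi> (indicator (\<Union>i<n. A i))" for n
    proof (induction n)
      case 0
      show ?case using scale[of "\<lambda>_. 0" 0] by (simp add: indicator_def)
    next
      case (Suc n)
      have "(\<Union>i<n. A i) \<inter> A n = {}"
        using A(2) by (auto simp: disjoint_family_on_def dest: less_imp_neq)
      then have "indicator (\<Union>i<Suc n. A i) =
          (\<lambda>x. indicator (\<Union>i<n. A i) x + indicator (A n) x :: real)"
        by (auto simp: fun_eq_iff lessThan_Suc split: split_indicator)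
      then show ?case
        using Suc A' by (simp add: \<nu>_def \<Phi>_add ind)
    qed
    moreover have "(\<lambda>n. \<Phi> (indicator (\<Union>i<n. A i))) \<longlonglongrightarrow> \<Phi> (indicator (\<Union>i. A i))"
      using A' by (intro cont[where w = "\<lambda>_. 1"] LIMSEQ_indicator_UN ind)
        (auto split: split_indicator)
    ultimately show "(\<lambda>n. \<nu> (A n)) sums \<nu> (\<Union>n. A n)"
      using A' by (simp add: sums_def) (simp add: \<nu>_def)
  qed (simp add: \<nu>_def)
  have null: "tot_var M \<nu> N = 0" if N: "N \<in> sets M" "emeasure M N = 0" for N
  proof -
    have "\<nu> B = 0" if "B \<in> sets M" "B \<subseteq> N" for B
      using \<nu>_bdd[OF that(1)] emeasure_mono[OF that(2) N(1)] N(2)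
      by (simp add: measure_def)
    then have "pos_var M \<nu> N \<le> 0" "pos_var M (\<lambda>A. - \<nu> A) N \<le> 0"
      by (intro pos_var_least; simp)+
    then show ?thesis by (simp add: tot_var_def neg_var_eq_pos_var)
  qed
  obtain f where f: "integrable M f" and \<nu>f: "\<nu> = signed_density M f"
    by (rule signed_radon_nikodym[OF finite_measure_axioms refl \<nu> null])
  have f_int: "(LINT x:A|M. f x) = \<nu> A" if "A \<in> sets M" for A
    using \<nu>f that by (simp add: signed_density_def)
  have "AE x in M. f x \<le> K"
    using \<nu>_bdd by (intro AE_le_of_set_integral_le f) (force simp: f_int)
  moreover have "AE x in M. - f x \<le> K"
  proof (intro AE_le_of_set_integral_le)
    fix A assume A: "A \<in> sets M"
    then have "(LINT x:A|M. - f x) = - \<nu> A"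
      by (simp add: f_int[symmetric]) (simp add: set_lebesgue_integral_def)
    then show "(LINT x:A|M. - f x) \<le> K * measure M A"
      using \<nu>_bdd[OF A] by linarith
  qed (use f in auto)
  ultimately have K: "AE x in M. \<bar>f x\<bar> \<le> K"
    by eventually_elim auto
  show ?thesis
  proof
    show [measurable]: "f \<in> borel_measurable M" using f by auto
    show "AE x in M. \<bar>f x\<bar> \<le> K" by fact
    fix g :: "'a \<Rightarrow> real" assume "integrable M g"
    then show "\<Phi> g = (\<integral>x. f x * g x \<partial>M)"
    proof induction
      case (base A c)
      then show ?case
        using scale[OF ind[of A], of c] f_int[of A]
        by (simp add: \<nu>_def set_lebesgue_integral_def mult.commute[of c] mult.commute[of "f _"]
            flip: mult.assoc)
    next
      case (add g h)
      then show ?case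
        using integrable_bounded_mult[OF _ \<open>f \<in> borel_measurable M\<close> K]
        by (simp add: distrib_left \<Phi>_add)
    next
      case (lim g s)
      note [measurable] = borel_measurable_integrable[OF lim.hyps(1)] borel_measurable_integrable[OF lim.hyps(4)]
      \<comment> \<open>The factor 2 in the dominating function is the bound
        \<open>\<bar>s i x\<bar> \<le> 2 * \<bar>g x\<bar>\<close> supplied by the induction rule
        for integrable functions.\<close>
      have "(\<lambda>i. \<Phi> (s i)) \<longlonglongrightarrow> \<Phi> g"
        using lim.hyps by (intro cont[where w = "\<lambda>x. 2 * \<bar>g x\<bar>"]) auto
      moreover have "(\<lambda>i. \<integral>x. f x * s i x \<partial>M) \<longlonglongrightarrow> (\<integral>x. f x * g x \<partial>M)"
      proof (rule integral_dominated_convergence[where w = "\<lambda>x. \<bar>f x * (2 * g x)\<bar>"])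
        show "integrable M (\<lambda>x. \<bar>f x * (2 * g x)\<bar>)"
          using lim.hyps(4) K by (intro integrable_abs integrable_bounded_mult) auto
        show "AE x in M. (\<lambda>i. f x * s i x) \<longlonglongrightarrow> f x * g x"
          using lim.hyps(2) by (intro AE_I2 tendsto_mult_left) auto
        show "AE x in M. norm (f x * s i x) \<le> \<bar>f x * (2 * g x)\<bar>" for i
          using lim.hyps(3)[of _ i] by (intro AE_I2) (simp add: abs_mult mult_left_mono)
      qed measurable
      ultimately show ?case
        using lim.IH LIMSEQ_unique by simp
    qed
  qed
qed

section \<open>Measures dominated by a convex family\<close>

text \<open>Were the mixture formula not a measure, \<open>measure_of\<close> would return the null
  measure; total mass 1 excludes this. Members of a convex family satisfy the hypothesis because the
  mixture is again in the family.\<close>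

lemma emeasure_mix_measure:
  assumes "prob_space (mix_measure M t P Q)" "A \<in> sets M"
  shows "emeasure (mix_measure M t P Q) A = ennreal t * emeasure P A + ennreal (1 - t) * emeasure Q A"
proof -
  have "emeasure (mix_measure M t P Q) (space M) = 1"
    using prob_space.emeasure_space_1[OF assms(1)] by (simp add: mix_measure_def)
  then show ?thesis
    using assms(2) unfolding mix_measure_def emeasure_measure_of_conv
    by (auto simp: sets.sigma_sets_eq split: if_splits)
qed

text \<open>No countable additivity is needed here: applied to a set function that is not a measure,
  \<^const>\<open>measure_of\<close> gives the null measure.\<close>

lemma sconv_null:
  assumes "R \<in> sconv M \<Q>"
  obtains Qs :: "nat \<Rightarrow> 'a measure" where "range Qs \<subseteq> \<Q>"
    "\<And>N. N \<in> sets M \<Longrightarrow> (\<And>k. emeasure (Qs k) N = 0) \<Longrightarrow> N \<in> null_sets R"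
proof -
  obtain c Qs where R: "R = measure_of (space M) (sets M) (\<lambda>A. \<Sum>k. ennreal (c k) * emeasure (Qs k) A)"
    and Qs: "range Qs \<subseteq> \<Q>"
    using assms by (auto simp: sconv_def)
  show ?thesis
  proof (rule that[OF Qs])
    fix N assume "N \<in> sets M" "\<And>k. emeasure (Qs k) N = 0"
    then show "N \<in> null_sets R"
      unfolding null_sets_def R emeasure_measure_of_conv by simp
  qed
qed

lemma AE_of_qs:
  assumes "prob_family M \<P>" "P \<in> \<P>" "qs M \<P> Pr"
  shows "AE x in P. Pr x"
proof -
  have sets: "sets P = sets M" using assms by (auto simp: prob_family_def)
  obtain N where "N \<in> sets M" "emeasure P N = 0" "{x \<in> space M. \<not> Pr x} \<subseteq> N"
    using assms by (auto simp: qs_def polar_def)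
  then show ?thesis
    using sets sets_eq_imp_space_eq[OF sets] by (intro AE_I'[of N]) auto
qed

text \<open>A family of measures may be uncountable, so null sets chosen separately for each member
  could not be united. Measurability of the exceptional set itself makes it a single polar
  witness.\<close>

lemma qsI:
  assumes "prob_family M \<P>" and meas: "{x \<in> space M. Pr x} \<in> sets M"
    and AE: "\<And>P. P \<in> \<P> \<Longrightarrow> AE x in P. Pr x"
  shows "qs M \<P> Pr"
  unfolding qs_def polar_def
proof (intro bexI conjI ballI)
  have "{x \<in> space M. \<not> Pr x} = space M - {x \<in> space M. Pr x}" by auto
  then show meas': "{x \<in> space M. \<not> Pr x} \<in> sets M" using meas by simp
  fix P assume P: "P \<in> \<P>"
  then have sets: "sets P = sets M" using assms by (auto simp: prob_family_def)
  show "emeasure P {x \<in> space M. \<not> Pr x} = 0"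
    using AE[OF P] meas' sets sets_eq_imp_space_eq[OF sets]
    by (subst (asm) AE_iff_measurable[OF _ refl]) auto
qed simp

text \<open>Radon-Nikodym gives the density; conversely the total variation of \<open>g dP\<close>
  is the integral of \<open>\<bar>g\<bar>\<close>, which vanishes on \<open>P\<close>-null sets.
  Later arguments on \<open>ca(\<P>)\<close> thus become computations with integrals.\<close>

lemma ca_iff_signed_density:
  assumes "prob_family M \<P>"
  shows "\<mu> \<in> ca M \<P> \<longleftrightarrow> (\<exists>P\<in>\<P>. \<exists>g. integrable P g \<and> \<mu> = signed_density P g)"
proof
  assume "\<mu> \<in> ca M \<P>"
  then obtain P where P: "P \<in> \<P>" "fin_signed_measure M \<mu>"
    and ac: "\<And>N. N \<in> sets M \<Longrightarrow> emeasure P N = 0 \<Longrightarrow> tot_var M \<mu> N = 0"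
    by (auto simp: ca_def)
  have "finite_measure P" "sets P = sets M"
    using assms P by (auto simp: prob_family_def prob_space_def)
  from signed_radon_nikodym[OF this P(2) ac] show "\<exists>P\<in>\<P>. \<exists>g. integrable P g \<and> \<mu> = signed_density P g"
    using P(1) by metis
next
  assume "\<exists>P\<in>\<P>. \<exists>g. integrable P g \<and> \<mu> = signed_density P g"
  then obtain P g where P: "P \<in> \<P>" and g: "integrable P g" and \<mu>: "\<mu> = signed_density P g"
    by auto
  have sets: "sets P = sets M" using assms P by (auto simp: prob_family_def)
  have "tot_var M \<mu> N = 0" if "N \<in> sets M" "emeasure P N = 0" for N
  proof -
    have "N \<in> null_sets P" using that sets by auto
    then show ?thesis
      unfolding \<mu> tot_var_signed_density[OF g sets that(1)] by (rule nn_integral_null_set)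
  qed
  then show "\<mu> \<in> ca M \<P>"
    using P fin_signed_measure_signed_density[OF g sets] unfolding ca_def \<mu> by auto
qed

text \<open>Radon-Nikodym for \<open>g dQ\<close> with respect to \<open>P\<close>. The domination
  condition concerns \<open>\<bar>g\<bar> dQ\<close> rather than \<open>Q\<close>, so that it
  applies to a measure restricted to one support of a localization.\<close>

lemma signed_density_change_of_measure:
  assumes "finite_measure P" "sets P = sets M" "sets Q = sets M" and g: "integrable Q g"
    and ac: "\<And>N. N \<in> sets M \<Longrightarrow> emeasure P N = 0 \<Longrightarrow> (\<integral>\<^sup>+x\<in>N. ennreal \<bar>g x\<bar> \<partial>Q) = 0"
  obtains h where "integrable P h" "signed_density Q g = signed_density P h"
proof (rule signed_radon_nikodym[OF assms(1,2) fin_signed_measure_signed_density[OF g assms(3)]])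
  show "tot_var M (signed_density Q g) N = 0" if "N \<in> sets M" "emeasure P N = 0" for N
    using ac[OF that] tot_var_signed_density[OF g assms(3) that(1)] by simp
qed (use that in blast)

lemma signed_density_absolutely_continuous:
  assumes "finite_measure P" "sets P = sets M" "sets Q = sets M" and g: "integrable Q g"
    and ac: "absolutely_continuous P Q"
  obtains h where "integrable P h" "signed_density Q g = signed_density P h"
proof (rule signed_density_change_of_measure[OF assms(1-4)])
  fix N assume "N \<in> sets M" "emeasure P N = 0"
  then have "N \<in> null_sets Q"
    using ac assms(2) by (auto simp: absolutely_continuous_def)
  then show "(\<integral>\<^sup>+x\<in>N. ennreal \<bar>g x\<bar> \<partial>Q) = 0" by (rule nn_integral_null_set)
qed (use that in blast)

text \<open>The equal mixture \<open>R\<close> of two dominating members lies in \<P> by convexity,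
  and its null sets are null for both of them. This is what makes \<open>ca(\<P>)\<close> closed
  under linear combinations.\<close>

lemma ca_common_density:
  assumes fam: "prob_family M \<P>" and conv: "convex_family M \<P>"
    and "\<mu> \<in> ca M \<P>" "\<nu> \<in> ca M \<P>"
  obtains R g h where "R \<in> \<P>" "integrable R g" "integrable R h"
    "\<mu> = signed_density R g" "\<nu> = signed_density R h"
proof -
  obtain P g Q h where P: "P \<in> \<P>" "integrable P g" "\<mu> = signed_density P g"
    and Q: "Q \<in> \<P>" "integrable Q h" "\<nu> = signed_density Q h"
    using assms(3,4) unfolding ca_iff_signed_density[OF fam] by metis
  define R where "R = mix_measure M (1/2) P Q"
  have R: "R \<in> \<P>" using conv P Q by (simp add: convex_family_def R_def)
  have prob: "prob_space X" and sets: "sets X = sets M" if "X \<in> \<P>" for X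
    using fam that by (auto simp: prob_family_def)
  have fin: "finite_measure R" using prob[OF R] by (simp add: prob_space_def)
  have "emeasure P N = 0 \<and> emeasure Q N = 0" if "N \<in> sets M" "emeasure R N = 0" for N
    using emeasure_mix_measure[of M "1/2" P Q N] prob[OF R] that by (simp add: R_def)
  then have "absolutely_continuous R P" "absolutely_continuous R Q"
    using sets R P Q by (auto simp: absolutely_continuous_def null_sets_def)
  then show ?thesis
    using signed_density_absolutely_continuous[OF fin sets[OF R] sets[OF P(1)] P(2)]
      signed_density_absolutely_continuous[OF fin sets[OF R] sets[OF Q(1)] Q(2)]
    by (metis P(3) Q(3) R that)
qed

section \<open>The pairing of bounded functions with \<open>ca(\<P>)\<close>\<close>

lemma signed_integral_Linf:
  assumes fam: "prob_family M \<P>" and P: "P \<in> \<P>" and f: "f \<in> Linf M \<P>" and g: "integrable P g"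
  shows "signed_integral M (signed_density P g) f = (\<integral>x. f x * g x \<partial>P)"
    and "integrable P (\<lambda>x. f x * g x)"
proof -
  obtain K where K: "AE x in P. \<bar>f x\<bar> \<le> K" and meas: "f \<in> borel_measurable M"
    using f AE_of_qs[OF fam P] by (auto simp: Linf_def)
  have sets: "sets P = sets M" using fam P by (auto simp: prob_family_def)
  show "signed_integral M (signed_density P g) f = (\<integral>x. f x * g x \<partial>P)"
    by (rule signed_integral_signed_density[OF g sets meas K])
  show "integrable P (\<lambda>x. f x * g x)"
    using meas measurable_cong_sets[OF sets refl] by (intro integrable_bounded_mult[OF g _ K]) blast
qed

lemma Linf_linear:
  assumes "f \<in> Linf M \<P>" "g \<in> Linf M \<P>" and fam: "prob_family M \<P>"
  shows "(\<lambda>x. a * f x + b * g x) \<in> Linf M \<P>"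
proof -
  obtain K L where f: "f \<in> borel_measurable M" "qs M \<P> (\<lambda>x. \<bar>f x\<bar> \<le> K)"
    and g: "g \<in> borel_measurable M" "qs M \<P> (\<lambda>x. \<bar>g x\<bar> \<le> L)"
    using assms by (auto simp: Linf_def)
  note [measurable] = f(1) g(1)
  have "qs M \<P> (\<lambda>x. \<bar>a * f x + b * g x\<bar> \<le> \<bar>a\<bar> * K + \<bar>b\<bar> * L)"
  proof (rule qsI[OF fam])
    fix P assume P: "P \<in> \<P>"
    show "AE x in P. \<bar>a * f x + b * g x\<bar> \<le> \<bar>a\<bar> * K + \<bar>b\<bar> * L"
      using AE_of_qs[OF fam P f(2)] AE_of_qs[OF fam P g(2)]
    proof eventually_elim
      case (elim x)
      then have "\<bar>a * f x\<bar> \<le> \<bar>a\<bar> * K" "\<bar>b * g x\<bar> \<le> \<bar>b\<bar> * L"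
        by (auto simp: abs_mult mult_left_mono)
      then show ?case by linarith
    qed
  qed measurable
  then show ?thesis by (auto simp: Linf_def)
qed

text \<open>Hoelder's inequality for the pair \<open>L^\<infinity>\<close>, \<open>L^1\<close>. It
  shows that \<open>l(f)\<close> is bounded, and with \<open>K = 0\<close> that \<open>l\<close>
  respects quasi-sure equality.\<close>

lemma signed_integral_bound:
  assumes fam: "prob_family M \<P>" and f: "f \<in> borel_measurable M"
    and K: "qs M \<P> (\<lambda>x. \<bar>f x\<bar> \<le> K)" and \<mu>: "\<mu> \<in> ca M \<P>"
  shows "\<bar>signed_integral M \<mu> f\<bar> \<le> K * tv_norm M \<mu>"
proof -
  obtain P g where P: "P \<in> \<P>" and g: "integrable P g" and \<mu>_eq: "\<mu> = signed_density P g"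
    using \<mu> unfolding ca_iff_signed_density[OF fam] by auto
  have sets: "sets P = sets M" using fam P by (auto simp: prob_family_def)
  have Linf: "f \<in> Linf M \<P>" using f K by (auto simp: Linf_def)
  have "\<bar>\<integral>x. f x * g x \<partial>P\<bar> \<le> (\<integral>x. \<bar>f x * g x\<bar> \<partial>P)"
    by (rule integral_abs_bound)
  also have "\<dots> \<le> (\<integral>x. K * \<bar>g x\<bar> \<partial>P)"
  proof (rule integral_mono_AE)
    show "AE x in P. \<bar>f x * g x\<bar> \<le> K * \<bar>g x\<bar>"
      using AE_of_qs[OF fam P K] by eventually_elim (simp add: abs_mult mult_right_mono)
  qed (use g signed_integral_Linf(2)[OF fam P Linf g] in auto)
  finally show ?thesis
    using signed_integral_Linf(1)[OF fam P Linf g] tv_norm_signed_density[OF g sets] g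
    by (simp add: \<mu>_eq)
qed

text \<open>Testing on the sign of \<open>f\<close> restricted to a set \<open>A\<close> bounds the
  integral of \<open>\<bar>f\<bar>\<close> over \<open>A\<close> by \<open>K * P(A)\<close>. This is
  the lower half of the isometry, and with \<open>K = 0\<close> it yields injectivity.\<close>

lemma qs_le_of_signed_integral_bound:
  assumes fam: "prob_family M \<P>" and f: "f \<in> Linf M \<P>"
    and K: "\<And>\<mu>. \<mu> \<in> ca M \<P> \<Longrightarrow> \<bar>signed_integral M \<mu> f\<bar> \<le> K * tv_norm M \<mu>"
  shows "qs M \<P> (\<lambda>x. \<bar>f x\<bar> \<le> K)"
proof (rule qsI[OF fam])
  have [measurable]: "f \<in> borel_measurable M" using f by (simp add: Linf_def)
  show "{x \<in> space M. \<bar>f x\<bar> \<le> K} \<in> sets M" by measurable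
  fix P assume P: "P \<in> \<P>"
  then have sets [measurable_cong]: "sets P = sets M" using fam by (auto simp: prob_family_def)
  interpret prob_space P using P fam by (auto simp: prob_family_def)
  have fP: "f \<in> borel_measurable P"
    using \<open>f \<in> borel_measurable M\<close> measurable_cong_sets[OF sets refl] by blast
  have intf: "integrable P (\<lambda>x. \<bar>f x\<bar>)"
    using signed_integral_Linf(2)[OF fam P f, of "\<lambda>_. 1"] by simp
  show "AE x in P. \<bar>f x\<bar> \<le> K"
  proof (rule AE_le_of_set_integral_le[OF intf])
    fix A assume A: "A \<in> sets P"
    \<comment> \<open>The sign is taken as 1 where \<open>f\<close> vanishes, so
      \<open>\<bar>g\<bar>\<close> is exactly the indicator of \<open>A\<close> and the total
      variation of \<open>g dP\<close> is \<open>P(A)\<close>.\<close>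
    define g :: "'a \<Rightarrow> real" where "g = (\<lambda>x. indicator A x * (if f x \<ge> 0 then 1 else - 1))"
    have g: "integrable P g"
    proof (rule integrable_const_bound[where B = 1])
      show "g \<in> borel_measurable P" unfolding g_def using A fP by measurable
    qed (auto simp: g_def split: split_indicator)
    have ca: "signed_density P g \<in> ca M \<P>"
      unfolding ca_iff_signed_density[OF fam] using P g by auto
    have "(LINT x:A|P. \<bar>f x\<bar>) = (\<integral>x. f x * g x \<partial>P)"
      unfolding set_lebesgue_integral_def g_def
      by (intro Bochner_Integration.integral_cong) (auto split: split_indicator)
    also have "\<dots> \<le> K * tv_norm M (signed_density P g)"
      using K[OF ca] signed_integral_Linf(1)[OF fam P f g] by simp
    also have "tv_norm M (signed_density P g) = (\<integral>x. \<bar>g x\<bar> \<partial>P)"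
      by (rule tv_norm_signed_density[OF g sets])
    also have "(\<lambda>x. \<bar>g x\<bar>) = indicator A"
      by (auto simp: g_def fun_eq_iff split: split_indicator)
    finally show "(LINT x:A|P. \<bar>f x\<bar>) \<le> K * measure P A"
      using A sets.sets_into_space[OF A] by (simp add: Int_absorb2)
  qed
qed

section \<open>Localizations and the dual space\<close>

text \<open>One inclusion is the covering property of \<open>T\<close>. The other is minimality:
  inside the support of \<open>R\<close>, a least cover can contain nothing beyond
  \<open>E R\<close> up to an \<open>R\<close>-null set.\<close>

lemma hahn_least_cover_AE_eq:
  assumes fam: "prob_family M \<Q>" and S: "\<And>Q. Q \<in> \<Q> \<Longrightarrow> S Q \<in> sets M"
    and supp: "\<And>Q R. Q \<in> \<Q> \<Longrightarrow> R \<in> \<Q> \<Longrightarrow> emeasure Q (S R) = (if Q = R then 1 else 0)"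
    and E: "\<And>Q. Q \<in> \<Q> \<Longrightarrow> E Q \<in> sets M \<and> E Q \<subseteq> S Q"
    and T: "T \<in> sets M" "\<And>Q. Q \<in> \<Q> \<Longrightarrow> emeasure Q (E Q - T) = 0"
    and least: "\<And>F Q. F \<in> sets M \<Longrightarrow> (\<And>Q. Q \<in> \<Q> \<Longrightarrow> emeasure Q (E Q - F) = 0) \<Longrightarrow>
      Q \<in> \<Q> \<Longrightarrow> emeasure Q (T - F) = 0"
    and R: "R \<in> \<Q>"
  shows "AE x in R. x \<in> T \<longleftrightarrow> x \<in> E R"
proof -
  have setsQ: "sets Q = sets M" if "Q \<in> \<Q>" for Q using fam that by (auto simp: prob_family_def)
  interpret R: prob_space R using fam R by (auto simp: prob_family_def)
  \<comment> \<open>This \<open>F\<close> omits only \<open>S R - E R\<close>. It contains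
    \<open>E R\<close>, and it covers every other \<open>E Q\<close> up to a subset of
    \<open>S R\<close>, which is \<open>Q\<close>-null; so minimality of \<open>T\<close> can be
    tested against it.\<close>
  define F where "F = space M - (S R - E R)"
  have F: "F \<in> sets M" using S[OF R] E[OF R] by (auto simp: F_def)
  have "emeasure Q (E Q - F) = 0" if Q: "Q \<in> \<Q>" for Q
  proof (cases "Q = R")
    case True
    then have "E Q - F = {}" using E[OF Q] sets.sets_into_space[of "E Q" M] by (auto simp: F_def)
    then show ?thesis by (simp only: emeasure_empty)
  next
    case False
    have "E Q - F \<subseteq> S R" using E[OF Q] sets.sets_into_space[of "E Q" M] by (auto simp: F_def)
    then have "emeasure Q (E Q - F) \<le> emeasure Q (S R)"
      using S[OF R] setsQ[OF Q] by (intro emeasure_mono) auto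
    then show ?thesis using supp[OF Q R] False by simp
  qed
  then have "emeasure R (T - F) = 0" by (intro least[OF F _ R]) auto
  then have "T - F \<in> null_sets R" "E R - T \<in> null_sets R"
    using T(1) T(2)[OF R] F E[OF R] setsQ[OF R] by (auto intro!: null_setsI)
  then have "AE x in R. x \<notin> T - F" "AE x in R. x \<notin> E R - T" by (auto simp only: AE_not_in)
  moreover have "AE x in R. x \<in> S R"
    using supp[OF R R] S[OF R] setsQ[OF R]
    by (intro R.AE_prob_1) (simp add: measure_def)
  ultimately show ?thesis
  proof eventually_elim
    case (elim x)
    then show ?case
      using E[OF R] T(1) sets.sets_into_space[of T M] by (auto simp: F_def)
  qed
qed

text \<open>A function is recovered from its superlevel sets at rational levels. Each level needs
  one application of the Hahn property, giving a set \<open>T r\<close> that agrees with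
  \<open>{f Q > r}\<close> almost surely under every \<open>Q\<close> at once.\<close>

lemma hahn_localization_glue:
  fixes f :: "'a measure \<Rightarrow> 'a \<Rightarrow> real"
  assumes fam: "prob_family M \<Q>" and S: "\<And>Q. Q \<in> \<Q> \<Longrightarrow> S Q \<in> sets M"
    and supp: "\<And>Q R. Q \<in> \<Q> \<Longrightarrow> R \<in> \<Q> \<Longrightarrow> emeasure Q (S R) = (if Q = R then 1 else 0)"
    and hahn: "\<And>E. (\<forall>Q\<in>\<Q>. E Q \<in> sets M \<and> E Q \<subseteq> S Q) \<Longrightarrow>
        (\<exists>T\<in>sets M. (\<forall>Q\<in>\<Q>. emeasure Q (E Q - T) = 0) \<and>
           (\<forall>F\<in>sets M. (\<forall>Q\<in>\<Q>. emeasure Q (E Q - F) = 0) \<longrightarrow>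
              (\<forall>Q\<in>\<Q>. emeasure Q (T - F) = 0)))"
    and f: "\<And>Q. Q \<in> \<Q> \<Longrightarrow> f Q \<in> borel_measurable M"
    and K: "\<And>Q. Q \<in> \<Q> \<Longrightarrow> AE x in Q. \<bar>f Q x\<bar> \<le> K" and "0 \<le> K"
  obtains h where "h \<in> borel_measurable M" "\<And>x. \<bar>h x\<bar> \<le> K"
    "\<And>Q. Q \<in> \<Q> \<Longrightarrow> AE x in Q. h x = f Q x"
proof -
  have setsQ: "sets Q = sets M" and probQ: "prob_space Q" if "Q \<in> \<Q>" for Q
    using fam that by (auto simp: prob_family_def)
  have "\<exists>T\<in>sets M. \<forall>Q\<in>\<Q>. AE x in Q. x \<in> T \<longleftrightarrow> f Q x > r" for r
  proof -
    define E where "E Q = S Q \<inter> {x \<in> space M. f Q x > r}" for Q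
    have "{x \<in> space M. f Q x > r} \<in> sets M" if "Q \<in> \<Q>" for Q
      using f[OF that] by measurable
    then have E: "\<forall>Q\<in>\<Q>. E Q \<in> sets M \<and> E Q \<subseteq> S Q" using S by (auto simp: E_def)
    from hahn[OF E] obtain T where T: "T \<in> sets M" "\<forall>Q\<in>\<Q>. emeasure Q (E Q - T) = 0"
      "\<forall>F\<in>sets M. (\<forall>Q\<in>\<Q>. emeasure Q (E Q - F) = 0) \<longrightarrow> (\<forall>Q\<in>\<Q>. emeasure Q (T - F) = 0)"
      by (elim bexE conjE)
    have "AE x in Q. x \<in> T \<longleftrightarrow> f Q x > r" if Q: "Q \<in> \<Q>" for Q
    proof -
      interpret prob_space Q by (rule probQ[OF Q])
      have "AE x in Q. x \<in> S Q"
        using supp[OF Q Q] S[OF Q] setsQ[OF Q] by (intro AE_prob_1) (simp add: measure_def)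
      moreover have "AE x in Q. x \<in> T \<longleftrightarrow> x \<in> E Q"
        by (rule hahn_least_cover_AE_eq[OF fam S supp E[rule_format] T(1) T(2)[rule_format]
              T(3)[rule_format] Q])
      moreover note AE_space
      ultimately show ?thesis
        by eventually_elim (auto simp: E_def sets_eq_imp_space_eq[OF setsQ[OF Q]])
    qed
    with T(1) show ?thesis by blast
  qed
  then obtain T where T [measurable]: "\<And>r. T r \<in> sets M"
    and Tf: "\<And>r Q. Q \<in> \<Q> \<Longrightarrow> AE x in Q. x \<in> T r \<longleftrightarrow> f Q x > r"
    by metis
  \<comment> \<open>Countability of the levels gives measurability of the supremum, and
    \<open>0 \<le> K\<close> puts 0 into \<open>I\<close>, so the supremum is over a nonempty
    set.\<close>
  define I where "I = \<rat> \<inter> {-K..K}"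
  \<comment> \<open>Off \<open>T r\<close> the value is the lower bound \<open>- K\<close>. Hence
    \<open>h\<close> stays in \<open>[-K, K]\<close> at every point, which later makes it bounded
    quasi-surely for \<P> as well.\<close>
  define u where "u r x = (if x \<in> T r then r else - K)" for r x
  define h where "h x = (SUP r\<in>I. u r x)" for x
  have I: "I \<noteq> {}" "countable I"
    using \<open>0 \<le> K\<close> countable_rat by (auto simp: I_def intro!: exI[of _ 0])
  have u: "- K \<le> u r x" "u r x \<le> K" if "r \<in> I" for r x
    using that by (auto simp: u_def I_def)
  have bdd: "bdd_above ((\<lambda>r. u r x) ` I)" for x
    using u by (intro bdd_aboveI2[of _ _ K]) auto
  show ?thesis
  proof
    show "h \<in> borel_measurable M"
      unfolding h_def using I(2)
    proof (rule borel_measurable_cSUP)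
      show "(\<lambda>x. u r x) \<in> borel_measurable M" for r unfolding u_def by measurable
    qed (rule bdd)
    show "\<bar>h x\<bar> \<le> K" for x
    proof -
      have "h x \<le> K" unfolding h_def using I(1) u by (intro cSUP_least) auto
      moreover obtain r where "r \<in> I" using I(1) by auto
      then have "- K \<le> h x"
        unfolding h_def using u by (intro cSUP_upper2[OF bdd, of r]) auto
      ultimately show ?thesis by simp
    qed
    fix Q assume Q: "Q \<in> \<Q>"
    have "AE x in Q. \<forall>r\<in>\<rat>. x \<in> T r \<longleftrightarrow> f Q x > r"
      using Tf[OF Q] by (subst AE_ball_countable[OF countable_rat]) auto
    with K[OF Q] show "AE x in Q. h x = f Q x"
    proof eventually_elim
      case (elim x)
      show ?case
      proof (rule antisym)
        show "h x \<le> f Q x"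
          unfolding h_def using I(1) elim by (intro cSUP_least) (auto simp: u_def I_def abs_le_iff)
        show "f Q x \<le> h x"
        proof (rule dense_le)
          fix z assume z: "z < f Q x"
          show "z \<le> h x"
          \<comment> \<open>At the bottom value no level of \<open>I\<close> lies below
            \<open>f Q x\<close>, and \<open>- K \<le> h x\<close> suffices. Otherwise a rational
            between \<open>max z (- K)\<close> and \<open>f Q x\<close> belongs to \<open>I\<close>
            and is attained by \<open>u\<close>.\<close>
          proof (cases "f Q x = - K")
            case True
            then show ?thesis using \<open>\<bar>h x\<bar> \<le> K\<close> z by auto
          next
            case False
            then have "max z (- K) < f Q x" using z elim by auto
            then obtain r where r: "r \<in> \<rat>" "max z (- K) < r" "r < f Q x"
              using Rats_dense_in_real by blast
            then have "r \<in> I" "u r x = r" using elim by (auto simp: I_def u_def)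
            then show ?thesis
              unfolding h_def using r by (intro cSUP_upper2[OF bdd, of r]) auto
          qed
        qed
      qed
    qed
  qed
qed

section \<open>Representation of bounded functionals on \<open>ca(\<P>)\<close>\<close>

lemma signed_density_in_ca:
  assumes fam: "prob_family M \<P>" and P: "P \<in> \<P>" and Q: "sets Q = sets M"
    and ac: "absolutely_continuous P Q" and g: "integrable Q g"
  shows "signed_density Q g \<in> ca M \<P>"
proof -
  have "finite_measure P" "sets P = sets M"
    using fam P by (auto simp: prob_family_def prob_space_def)
  then obtain h where "integrable P h" "signed_density Q g = signed_density P h"
    using signed_density_absolutely_continuous[OF _ _ Q g ac] by metis
  with P show ?thesis unfolding ca_iff_signed_density[OF fam] by auto
qed

text \<open>The functional is pulled back along the isometry \<open>g \<mapsto> g dQ\<close> and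
  represented on \<open>L^1(Q)\<close>. As \<open>Q\<close> only has to be dominated by a member of
  \<P>, this covers members of the localization and members of \<P> alike.\<close>

lemma ca_dual_representation_on:
  assumes fam: "prob_family M \<P>" and P: "P \<in> \<P>"
    and Q: "finite_measure Q" "sets Q = sets M" "absolutely_continuous P Q"
    and lin: "\<And>\<mu> \<nu> a b. \<mu> \<in> ca M \<P> \<Longrightarrow> \<nu> \<in> ca M \<P> \<Longrightarrow>
        \<phi> (\<lambda>A. a * \<mu> A + b * \<nu> A) = a * \<phi> \<mu> + b * \<phi> \<nu>"
    and bound: "\<And>\<mu>. \<mu> \<in> ca M \<P> \<Longrightarrow> \<bar>\<phi> \<mu>\<bar> \<le> K * tv_norm M \<mu>"
  obtains f where "f \<in> borel_measurable M" "AE x in Q. \<bar>f x\<bar> \<le> K"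
    "\<And>g. integrable Q g \<Longrightarrow> \<phi> (signed_density Q g) = (\<integral>x. f x * g x \<partial>Q)"
proof -
  interpret finite_measure Q by fact
  note ca = signed_density_in_ca[OF fam P Q(2,3)]
  obtain f where "f \<in> borel_measurable Q" "AE x in Q. \<bar>f x\<bar> \<le> K"
    "\<And>g. integrable Q g \<Longrightarrow> \<phi> (signed_density Q g) = (\<integral>x. f x * g x \<partial>Q)"
  proof (rule L1_dual_representation[of "\<lambda>g. \<phi> (signed_density Q g)" K])
    show "\<phi> (signed_density Q (\<lambda>x. a * g x + b * h x)) =
        a * \<phi> (signed_density Q g) + b * \<phi> (signed_density Q h)"
      if "integrable Q g" "integrable Q h" for g h a b
      unfolding signed_density_linear[OF that] by (intro lin ca that)
    show "\<bar>\<phi> (signed_density Q g)\<bar> \<le> K * (\<integral>x. \<bar>g x\<bar> \<partial>Q)" if "integrable Q g" for g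
      using bound[OF ca[OF that]] tv_norm_signed_density[OF that Q(2)] by simp
  qed (rule that)
  then show ?thesis
    using that measurable_cong_sets[OF Q(2) refl] by blast
qed

text \<open>Countably many supports carry \<open>P\<close>. On each of them \<open>P\<close> is
  dominated by the corresponding \<open>Q\<close>, so \<phi> can be evaluated on restrictions of
  \<open>P\<close> both through \<open>f\<close> and through \<open>fP\<close>; equal integrals over
  all subsets force equality almost everywhere.\<close>

lemma localization_AE_eq:
  fixes f fP :: "'a \<Rightarrow> real"
  assumes fam: "prob_family M \<P>" and loc: "localization M \<P> \<Q> S" and P: "P \<in> \<P>"
    and f: "f \<in> borel_measurable M" "\<And>x. \<bar>f x\<bar> \<le> K"
    and fP: "fP \<in> borel_measurable M" "AE x in P. \<bar>fP x\<bar> \<le> K"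
    and rep_f: "\<And>Q g. Q \<in> \<Q> \<Longrightarrow> integrable Q g \<Longrightarrow> \<phi> (signed_density Q g) = (\<integral>x. f x * g x \<partial>Q)"
    and rep_fP: "\<And>g. integrable P g \<Longrightarrow> \<phi> (signed_density P g) = (\<integral>x. fP x * g x \<partial>P)"
  shows "AE x in P. f x = fP x"
proof -
  have famQ: "prob_family M \<Q>" and S: "\<And>Q. Q \<in> \<Q> \<Longrightarrow> S Q \<in> sets M"
    and supp: "\<And>Q R. Q \<in> \<Q> \<Longrightarrow> R \<in> \<Q> \<Longrightarrow> emeasure Q (S R) = (if Q = R then 1 else 0)"
    and dom: "abs_cont_fam \<P> (sconv M \<Q>)"
    using loc by (auto simp: localization_def)
  have probQ: "prob_space Q" and setsQ: "sets Q = sets M" if "Q \<in> \<Q>" for Q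
    using famQ that by (auto simp: prob_family_def)
  have setsP: "sets P = sets M" using fam P by (auto simp: prob_family_def)
  interpret P: prob_space P using fam P by (auto simp: prob_family_def)
  have [measurable]: "f \<in> borel_measurable P" "fP \<in> borel_measurable P"
    using f fP measurable_cong_sets[OF setsP refl] by blast+
  obtain R where "R \<in> sconv M \<Q>" and RP: "absolutely_continuous R P"
    using dom P by (auto simp: abs_cont_fam_def)
  then obtain Qs :: "nat \<Rightarrow> 'a measure" where Qs: "range Qs \<subseteq> \<Q>"
    and nullR: "\<And>N. N \<in> sets M \<Longrightarrow> (\<And>k. emeasure (Qs k) N = 0) \<Longrightarrow> N \<in> null_sets R"
    using sconv_null by blast
  have null: "N \<in> null_sets P" if "N \<in> sets M" "\<And>k. emeasure (Qs k) N = 0" for N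
    using RP nullR[OF that] by (auto simp: absolutely_continuous_def)
  have Qk: "Qs k \<in> \<Q>" for k using Qs by auto
  have Sk [measurable]: "S (Qs k) \<in> sets P" for k using S[OF Qk] setsP by simp
  \<comment> \<open>Each \<open>Qs j\<close> gives mass 1 to its own support, so the complement of
    the union is null for all of them and hence for \<open>P\<close>.\<close>
  have "AE x in P. \<exists>k. x \<in> S (Qs k)"
  proof -
    have "space M - (\<Union>k. S (Qs k)) \<in> null_sets P"
    proof (rule null)
      show "space M - (\<Union>k. S (Qs k)) \<in> sets M" using S[OF Qk] by auto
      fix j
      interpret prob_space "Qs j" by (rule probQ[OF Qk])
      have "emeasure (Qs j) (space M - S (Qs j)) = 0"
        using emeasure_compl[of "S (Qs j)" "Qs j"] S[OF Qk] setsQ[OF Qk]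
          sets_eq_imp_space_eq[OF setsQ[OF Qk]] supp[OF Qk Qk, of j j] emeasure_space_1
        by simp
      moreover have "emeasure (Qs j) (space M - (\<Union>k. S (Qs k))) \<le>
          emeasure (Qs j) (space M - S (Qs j))"
        using S[OF Qk] setsQ[OF Qk] by (intro emeasure_mono) auto
      ultimately show "emeasure (Qs j) (space M - (\<Union>k. S (Qs k))) = 0" by simp
    qed
    then have "AE x in P. x \<notin> space M - (\<Union>k. S (Qs k))" by (rule AE_not_in)
    with AE_space show ?thesis
      by eventually_elim (auto simp: sets_eq_imp_space_eq[OF setsP])
  qed
  moreover have "AE x in P. \<forall>k. (f x - fP x) * indicator (S (Qs k)) x = 0"
    unfolding AE_all_countable
  proof
    fix k
    let ?S = "S (Qs k)" and ?Q = "Qs k"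
    have indS: "integrable P (indicator (?S \<inter> B) :: 'a \<Rightarrow> real)" if "B \<in> sets P" for B
      using that by (simp add: integrable_indicator_iff P.emeasure_eq_measure)
    have bd: "integrable P (\<lambda>x. f x * g x)" "integrable P (\<lambda>x. fP x * g x)"
      if "integrable P g" for g :: "'a \<Rightarrow> real"
      using f(2) by (auto intro!: integrable_bounded_mult[OF that, of _ K] fP(2))
    show "AE x in P. (f x - fP x) * indicator ?S x = 0"
    proof (rule P.density_zero)
      show "integrable P (\<lambda>x. (f x - fP x) * indicator ?S x)"
        using bd[OF indS[OF sets.top]] sets.sets_into_space[OF Sk]
        by (simp add: left_diff_distrib Int_absorb2)
      fix B assume B [measurable]: "B \<in> sets P"
      let ?g = "indicator (?S \<inter> B) :: 'a \<Rightarrow> real"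
      \<comment> \<open>This is the domination of \<open>P\<close> restricted to the support by
        \<open>?Q\<close>: a \<open>?Q\<close>-null part of the support is also null under every
        other measure of the sequence, since these vanish on the whole support.\<close>
      have N: "(\<integral>\<^sup>+x\<in>N. ennreal \<bar>?g x\<bar> \<partial>P) = 0"
        if N: "N \<in> sets M" "emeasure ?Q N = 0" for N
      proof -
        have "emeasure (Qs j) (?S \<inter> N) = 0" for j
        \<comment> \<open>The cases compare the measures and not the indices, because the sequence
          may list a measure repeatedly.\<close>
        proof (cases "Qs j = ?Q")
          case True
          then show ?thesis
            using N emeasure_mono[of "?S \<inter> N" N ?Q] setsQ[OF Qk] by auto
        next
          case False
          then show ?thesis
            using supp[OF Qk Qk, of j k] emeasure_mono[of "?S \<inter> N" ?S "Qs j"] setsQ[OF Qk] S[OF Qk]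
            by auto
        qed
        then have "?S \<inter> N \<in> null_sets P" using N S[OF Qk] by (intro null) auto
        then have "(\<integral>\<^sup>+x\<in>?S \<inter> N. 1 \<partial>P) = 0" by (rule nn_integral_null_set)
        moreover have "(\<integral>\<^sup>+x\<in>N. ennreal \<bar>?g x\<bar> \<partial>P) \<le> (\<integral>\<^sup>+x\<in>?S \<inter> N. 1 \<partial>P)"
          by (intro nn_integral_mono) (auto split: split_indicator)
        ultimately show ?thesis by simp
      qed
      have finQ: "finite_measure ?Q" using probQ[OF Qk] by (simp add: prob_space_def)
      obtain h where h: "integrable ?Q h" and eq: "signed_density P ?g = signed_density ?Q h"
        using signed_density_change_of_measure[OF finQ setsQ[OF Qk] setsP indS[OF B] N] by metis
      \<comment> \<open>The signed integral depends on the signed measure alone, so the integral of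
        \<open>f\<close> passes from the density \<open>?g\<close> under \<open>P\<close> to the
        density \<open>h\<close> under \<open>?Q\<close>, where \<open>f\<close> represents
        \<phi>.\<close>
      have "(\<integral>x. f x * ?g x \<partial>P) = signed_integral M (signed_density P ?g) f"
        using f indS[OF B] setsP by (intro signed_integral_signed_density[symmetric]) auto
      also have "\<dots> = (\<integral>x. f x * h x \<partial>?Q)"
        unfolding eq using f h setsQ[OF Qk] by (intro signed_integral_signed_density) auto
      also have "\<dots> = \<phi> (signed_density P ?g)"
        unfolding eq by (rule rep_f[OF Qk h, symmetric])
      also have "\<dots> = (\<integral>x. fP x * ?g x \<partial>P)"
        by (rule rep_fP[OF indS[OF B]])
      finally have "(\<integral>x. f x * ?g x - fP x * ?g x \<partial>P) = 0"
        using bd[OF indS[OF B]] by simp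
      moreover have "(LINT x:B|P. (f x - fP x) * indicator ?S x) =
          (\<integral>x. f x * ?g x - fP x * ?g x \<partial>P)"
        unfolding set_lebesgue_integral_def
        by (intro Bochner_Integration.integral_cong) (auto split: split_indicator)
      ultimately show "(LINT x:B|P. (f x - fP x) * indicator ?S x) = 0" by simp
    qed
  qed
  ultimately show ?thesis
    by eventually_elim (auto simp: indicator_def)
qed

lemma ca_dual_representation:
  assumes fam: "prob_family M \<P>" and hahn: "hahn_localizable M \<P>" and \<phi>: "\<phi> \<in> ca_dual M \<P>"
  obtains f where "f \<in> Linf M \<P>" "\<And>\<mu>. \<mu> \<in> ca M \<P> \<Longrightarrow> \<phi> \<mu> = signed_integral M \<mu> f"
proof -
  obtain \<Q> S where loc: "localization M \<P> \<Q> S" and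
    ext: "\<And>E. (\<forall>Q\<in>\<Q>. E Q \<in> sets M \<and> E Q \<subseteq> S Q) \<Longrightarrow>
        (\<exists>T\<in>sets M. (\<forall>Q\<in>\<Q>. emeasure Q (E Q - T) = 0) \<and>
           (\<forall>F\<in>sets M. (\<forall>Q\<in>\<Q>. emeasure Q (E Q - F) = 0) \<longrightarrow>
              (\<forall>Q\<in>\<Q>. emeasure Q (T - F) = 0)))"
    using hahn unfolding hahn_localizable_def by metis
  have famQ: "prob_family M \<Q>" and S: "\<And>Q. Q \<in> \<Q> \<Longrightarrow> S Q \<in> sets M"
    and supp: "\<And>Q R. Q \<in> \<Q> \<Longrightarrow> R \<in> \<Q> \<Longrightarrow> emeasure Q (S R) = (if Q = R then 1 else 0)"
    and dom: "abs_cont_fam \<Q> \<P>"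
    using loc by (auto simp: localization_def)
  obtain K where lin: "\<And>\<mu> \<nu> a b. \<mu> \<in> ca M \<P> \<Longrightarrow> \<nu> \<in> ca M \<P> \<Longrightarrow>
        \<phi> (\<lambda>A. a * \<mu> A + b * \<nu> A) = a * \<phi> \<mu> + b * \<phi> \<nu>"
    and "0 \<le> K" and bound: "\<And>\<mu>. \<mu> \<in> ca M \<P> \<Longrightarrow> \<bar>\<phi> \<mu>\<bar> \<le> K * tv_norm M \<mu>"
  proof -
    obtain L where L: "\<forall>\<mu>\<in>ca M \<P>. \<bar>\<phi> \<mu>\<bar> \<le> L * tv_norm M \<mu>"
      using \<phi> by (auto simp: ca_dual_def)
    \<comment> \<open>The bound in \<open>ca_dual\<close> may be negative, whereas gluing requires a
      nonnegative one; \<open>max 0 L\<close> is still a bound.\<close>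
    have "L * tv_norm M \<mu> \<le> max 0 L * tv_norm M \<mu>" for \<mu>
      by (intro mult_right_mono) (auto simp: tv_norm_def)
    with L have "\<bar>\<phi> \<mu>\<bar> \<le> max 0 L * tv_norm M \<mu>" if "\<mu> \<in> ca M \<P>" for \<mu>
      using that order_trans by blast
    with \<phi> that[of "max 0 L"] show ?thesis by (auto simp: ca_dual_def)
  qed
  note rep = ca_dual_representation_on[OF fam _ _ _ _ lin bound]
  have "\<forall>Q\<in>\<Q>. \<exists>f. f \<in> borel_measurable M \<and> (AE x in Q. \<bar>f x\<bar> \<le> K) \<and>
      (\<forall>g. integrable Q g \<longrightarrow> \<phi> (signed_density Q g) = (\<integral>x. f x * g x \<partial>Q))"
  proof
    fix Q assume Q: "Q \<in> \<Q>"
    then obtain P where P: "P \<in> \<P>" "absolutely_continuous P Q"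
      using dom by (auto simp: abs_cont_fam_def)
    have "finite_measure Q" "sets Q = sets M"
      using famQ Q by (auto simp: prob_family_def prob_space_def)
    from rep[OF P(1) this P(2)] show "\<exists>f. f \<in> borel_measurable M \<and> (AE x in Q. \<bar>f x\<bar> \<le> K) \<and>
      (\<forall>g. integrable Q g \<longrightarrow> \<phi> (signed_density Q g) = (\<integral>x. f x * g x \<partial>Q))"
      by metis
  qed
  then obtain F where F: "\<And>Q. Q \<in> \<Q> \<Longrightarrow> F Q \<in> borel_measurable M"
    "\<And>Q. Q \<in> \<Q> \<Longrightarrow> AE x in Q. \<bar>F Q x\<bar> \<le> K"
    "\<And>Q g. Q \<in> \<Q> \<Longrightarrow> integrable Q g \<Longrightarrow> \<phi> (signed_density Q g) = (\<integral>x. F Q x * g x \<partial>Q)"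
    by metis
  obtain f where f: "f \<in> borel_measurable M" "\<And>x. \<bar>f x\<bar> \<le> K"
    and fF: "\<And>Q. Q \<in> \<Q> \<Longrightarrow> AE x in Q. f x = F Q x"
    by (rule hahn_localization_glue[OF famQ S supp ext F(1,2) \<open>0 \<le> K\<close>];
        (assumption | rule that))
  have rep_f: "\<phi> (signed_density Q g) = (\<integral>x. f x * g x \<partial>Q)"
    if Q: "Q \<in> \<Q>" and g: "integrable Q g" for Q g
  proof -
    have sets: "sets Q = sets M" using famQ Q by (auto simp: prob_family_def)
    have [measurable]: "f \<in> borel_measurable Q" "F Q \<in> borel_measurable Q"
      using f(1) F(1)[OF Q] measurable_cong_sets[OF sets refl] by blast+
    note [measurable] = borel_measurable_integrable[OF g]
    have "(\<integral>x. F Q x * g x \<partial>Q) = (\<integral>x. f x * g x \<partial>Q)"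
      using fF[OF Q] by (intro integral_cong_AE) auto
    then show ?thesis using F(3)[OF Q g] by simp
  qed
  show ?thesis
  proof
    show Linf: "f \<in> Linf M \<P>"
      using f by (auto simp: Linf_def qs_def polar_def intro!: exI[of _ K])
    fix \<mu> assume "\<mu> \<in> ca M \<P>"
    then obtain P g where P: "P \<in> \<P>" and g: "integrable P g" and \<mu>: "\<mu> = signed_density P g"
      unfolding ca_iff_signed_density[OF fam] by auto
    have setsP: "sets P = sets M" and finP: "finite_measure P"
      using fam P by (auto simp: prob_family_def prob_space_def)
    \<comment> \<open>Since \<open>P\<close> dominates itself, \<phi> also has a representing
      function \<open>fP\<close> on \<open>L^1(P)\<close>. It remains to identify \<open>fP\<close>
      with the glued function \<open>f\<close>, which was built from the localization and does not
      depend on \<open>P\<close>.\<close>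
    have "absolutely_continuous P P" by (simp add: absolutely_continuous_def)
    from rep[OF P finP setsP this] obtain fP where fP: "fP \<in> borel_measurable M" "AE x in P. \<bar>fP x\<bar> \<le> K"
      "\<And>g. integrable P g \<Longrightarrow> \<phi> (signed_density P g) = (\<integral>x. fP x * g x \<partial>P)"
      by metis
    have [measurable]: "f \<in> borel_measurable P" "fP \<in> borel_measurable P"
      using f(1) fP(1) measurable_cong_sets[OF setsP refl] by blast+
    note [measurable] = borel_measurable_integrable[OF g]
    have "AE x in P. f x = fP x"
      by (rule localization_AE_eq[OF fam loc P f fP(1,2) rep_f fP(3)])
    then have "(\<integral>x. fP x * g x \<partial>P) = (\<integral>x. f x * g x \<partial>P)"
      by (intro integral_cong_AE) auto
    then show "\<phi> \<mu> = signed_integral M \<mu> f"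
      using fP(3)[OF g] signed_integral_Linf(1)[OF fam P Linf g] by (simp add: \<mu>)
  qed
qed

section \<open>The isometry and the assembly of the isomorphism\<close>

lemma dual_norm_signed_integral:
  assumes fam: "prob_family M \<P>" and f: "f \<in> Linf M \<P>"
  shows "dual_norm M \<P> (\<lambda>\<mu>. signed_integral M \<mu> f) = linf_norm M \<P> f"
proof -
  \<comment> \<open>The dual norm admits the bound \<open>K = 0\<close> while
    \<open>linf_norm\<close> asks for \<open>K > 0\<close>. The bounds otherwise coincide, and
    increasing a bound by an arbitrary positive amount shows that both sets have the same
    infimum.\<close>
  define A where "A = {K. K \<ge> 0 \<and> qs M \<P> (\<lambda>x. \<bar>f x\<bar> \<le> K)}"
  define B where "B = {K. K > 0 \<and> qs M \<P> (\<lambda>x. \<bar>f x\<bar> \<le> K)}"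
  have meas: "f \<in> borel_measurable M" using f by (simp add: Linf_def)
  have dual: "{K. K \<ge> 0 \<and> (\<forall>\<mu>\<in>ca M \<P>. \<bar>signed_integral M \<mu> f\<bar> \<le> K * tv_norm M \<mu>)} = A"
    unfolding A_def
    using signed_integral_bound[OF fam meas] qs_le_of_signed_integral_bound[OF fam f] by blast
  have mono: "qs M \<P> (\<lambda>x. \<bar>f x\<bar> \<le> L)" if "qs M \<P> (\<lambda>x. \<bar>f x\<bar> \<le> K)" "K \<le> L" for K L
  proof -
    have "{x \<in> space M. \<not> \<bar>f x\<bar> \<le> L} \<subseteq> {x \<in> space M. \<not> \<bar>f x\<bar> \<le> K}" using that(2) by auto
    then show ?thesis using that(1) unfolding qs_def polar_def by (meson order_trans)
  qed
  obtain K where K: "qs M \<P> (\<lambda>x. \<bar>f x\<bar> \<le> K)" using f by (auto simp: Linf_def)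
  then have ne: "B \<noteq> {}" using mono[OF K, of "max 1 K"] by (auto simp: B_def intro!: exI[of _ "max 1 K"])
  have sub: "B \<subseteq> A" by (auto simp: A_def B_def)
  have bdd: "bdd_below A" "bdd_below B" by (auto simp: A_def B_def intro!: bdd_belowI[of _ 0])
  have "Inf A = Inf B"
  proof (rule antisym)
    show "Inf A \<le> Inf B" using ne bdd sub by (intro cInf_superset_mono) auto
    show "Inf B \<le> Inf A"
    proof (rule cInf_greatest)
      show "A \<noteq> {}" using ne sub by auto
      fix K assume K: "K \<in> A"
      show "Inf B \<le> K"
      proof (rule field_le_epsilon)
        fix e :: real assume "0 < e"
        then have "K + e \<in> B" using K mono[of K "K + e"] by (auto simp: A_def B_def)
        then show "Inf B \<le> K + e" using bdd by (intro cInf_lower)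
      qed
    qed
  qed
  then show ?thesis by (simp add: dual_norm_def linf_norm_def dual B_def)
qed

text \<open>Quotient spaces are not formed: agreement on quasi-surely equal representatives makes
  \<open>l\<close> well defined on classes, and injectivity is likewise stated modulo quasi-sure
  equality.\<close>

theorem theorem3p4:
  fixes M :: "'a measure" and \<P> :: "'a measure set"
  assumes "prob_family M \<P>"
    and "convex_family M \<P>"
    and "hahn_localizable M \<P>"
  defines "l \<equiv> (\<lambda>f \<mu>. signed_integral M \<mu> f)"
  shows
    "(\<forall>f\<in>Linf M \<P>. l f \<in> ca_dual M \<P>)
   \<and> (\<forall>f\<in>Linf M \<P>. \<forall>g\<in>Linf M \<P>. qs M \<P> (\<lambda>x. f x = g x) \<longrightarrow>
        (\<forall>\<mu>\<in>ca M \<P>. l f \<mu> = l g \<mu>))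
   \<and> (\<forall>f\<in>Linf M \<P>. \<forall>g\<in>Linf M \<P>. \<forall>a b::real. \<forall>\<mu>\<in>ca M \<P>.
        l (\<lambda>x. a * f x + b * g x) \<mu> = a * l f \<mu> + b * l g \<mu>)
   \<and> (\<forall>f\<in>Linf M \<P>. dual_norm M \<P> (l f) = linf_norm M \<P> f)
   \<and> (\<forall>f\<in>Linf M \<P>. \<forall>g\<in>Linf M \<P>. (\<forall>\<mu>\<in>ca M \<P>. l f \<mu> = l g \<mu>) \<longrightarrow>
        qs M \<P> (\<lambda>x. f x = g x))
   \<and> (\<forall>\<phi>\<in>ca_dual M \<P>. \<exists>f\<in>Linf M \<P>. \<forall>\<mu>\<in>ca M \<P>. \<phi> \<mu> = l f \<mu>)"
proof (intro conjI ballI allI impI)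
  note fam = assms(1) and conv = assms(2)
  have l: "l f \<mu> = signed_integral M \<mu> f" for f \<mu> by (simp add: l_def)
  have linear: "l (\<lambda>x. a * f x + b * g x) \<mu> = a * l f \<mu> + b * l g \<mu>"
    if f: "f \<in> Linf M \<P>" and g: "g \<in> Linf M \<P>" and \<mu>: "\<mu> \<in> ca M \<P>" for f g a b \<mu>
  proof -
    obtain P h where P: "P \<in> \<P>" and h: "integrable P h" and eq: "\<mu> = signed_density P h"
      using \<mu> unfolding ca_iff_signed_density[OF fam] by auto
    have "(\<integral>x. (a * f x + b * g x) * h x \<partial>P) = (\<integral>x. a * (f x * h x) + b * (g x * h x) \<partial>P)"
      by (intro Bochner_Integration.integral_cong) (auto simp: algebra_simps)
    also have "\<dots> = a * (\<integral>x. f x * h x \<partial>P) + b * (\<integral>x. g x * h x \<partial>P)"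
      using signed_integral_Linf(2)[OF fam P f h] signed_integral_Linf(2)[OF fam P g h] by simp
    finally show ?thesis
      unfolding l eq using signed_integral_Linf(1)[OF fam P _ h] f g Linf_linear[OF f g fam]
      by simp
  qed
  then show "l (\<lambda>x. a * f x + b * g x) \<mu> = a * l f \<mu> + b * l g \<mu>"
    if "f \<in> Linf M \<P>" "g \<in> Linf M \<P>" "\<mu> \<in> ca M \<P>" for f g a b \<mu>
    using that .
  show "l f \<in> ca_dual M \<P>" if f: "f \<in> Linf M \<P>" for f
    unfolding ca_dual_def
  proof (intro CollectI conjI ballI allI)
    fix \<mu> \<nu> and a b :: real assume "\<mu> \<in> ca M \<P>" "\<nu> \<in> ca M \<P>"
    \<comment> \<open>Linearity in the measure is where convexity enters: with one dominating
      \<open>R\<close>, the combination of the measures has the combined density.\<close>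
    then obtain R g h where R: "R \<in> \<P>" and g: "integrable R g" and h: "integrable R h"
      and eq: "\<mu> = signed_density R g" "\<nu> = signed_density R h"
      by (rule ca_common_density[OF fam conv])
    have "(\<integral>x. f x * (a * g x + b * h x) \<partial>R) = (\<integral>x. a * (f x * g x) + b * (f x * h x) \<partial>R)"
      by (intro Bochner_Integration.integral_cong) (auto simp: algebra_simps)
    also have "\<dots> = a * (\<integral>x. f x * g x \<partial>R) + b * (\<integral>x. f x * h x \<partial>R)"
      using signed_integral_Linf(2)[OF fam R f g] signed_integral_Linf(2)[OF fam R f h] by simp
    finally show "l f (\<lambda>A. a * \<mu> A + b * \<nu> A) = a * l f \<mu> + b * l f \<nu>"
      unfolding l eq signed_density_linear[OF g h, symmetric]
      using signed_integral_Linf(1)[OF fam R f] g h by simp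
  next
    obtain K where "f \<in> borel_measurable M" "qs M \<P> (\<lambda>x. \<bar>f x\<bar> \<le> K)"
      using f by (auto simp: Linf_def)
    then show "\<exists>K. \<forall>\<mu>\<in>ca M \<P>. \<bar>l f \<mu>\<bar> \<le> K * tv_norm M \<mu>"
      unfolding l using signed_integral_bound[OF fam] by blast
  qed
  have diff: "(\<lambda>x. f x - g x) \<in> Linf M \<P>" "l (\<lambda>x. f x - g x) \<mu> = l f \<mu> - l g \<mu>"
    if "f \<in> Linf M \<P>" "g \<in> Linf M \<P>" "\<mu> \<in> ca M \<P>" for f g \<mu>
    using Linf_linear[OF that(1,2) fam, of 1 "-1"] linear[OF that, of 1 "-1"] by auto
  show "l f \<mu> = l g \<mu>"
    if "f \<in> Linf M \<P>" "g \<in> Linf M \<P>" "qs M \<P> (\<lambda>x. f x = g x)" "\<mu> \<in> ca M \<P>" for f g \<mu>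
    \<comment> \<open>Quasi-sure equality is the bound \<open>K = 0\<close> for the difference, so
      the pairing with the difference vanishes.\<close>
    using signed_integral_bound[OF fam, of "\<lambda>x. f x - g x" 0 \<mu>] diff[OF that(1,2,4)] that(3,4)
    by (simp add: l Linf_def)
  show "dual_norm M \<P> (l f) = linf_norm M \<P> f" if "f \<in> Linf M \<P>" for f
    using dual_norm_signed_integral[OF fam that] by (simp add: l_def)
  show "qs M \<P> (\<lambda>x. f x = g x)"
    if fg: "f \<in> Linf M \<P>" "g \<in> Linf M \<P>" "\<forall>\<mu>\<in>ca M \<P>. l f \<mu> = l g \<mu>" for f g
  proof -
    have "(\<lambda>x. f x - g x) \<in> Linf M \<P>" using Linf_linear[OF fg(1,2) fam, of 1 "-1"] by simp
    \<comment> \<open>The pairing with the difference vanishes identically, hence satisfies the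
      bound with \<open>K = 0\<close>, and the difference is zero quasi-surely.\<close>
    from qs_le_of_signed_integral_bound[OF fam this, of 0] show ?thesis
      using diff[OF fg(1,2)] fg(3) by (simp add: l)
  qed
  show "\<exists>f\<in>Linf M \<P>. \<forall>\<mu>\<in>ca M \<P>. \<phi> \<mu> = l f \<mu>" if "\<phi> \<in> ca_dual M \<P>" for \<phi>
    using ca_dual_representation[OF fam assms(3) that] unfolding l by metis
qed

end
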